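(* The following holds in $\mathsf{ZF}$ (Zermelo--Fraenkel set theory, without the axiom of choice). Let $\Sigma$ be a first-order signature. A class $\mathcal{K}$ of $\Sigma$-structures is a variety if and only if $\mathcal{K}$ is closed under homomorphic images, substructures, and products.
   Context: The background theory is $\mathsf{ZF}$; the axiom of choice may not be used. A first-order signature $\Sigma$ is a set of relation and function symbols, each having a fixed finite arity (constants are $0$-ary function symbols). Formulas are those of first-order logic with equality; atomic formulas are equations between terms and formulas $r(t_1,\dots,t_n)$ with $r$ a relation symbol of $\Sigma$. Structures have nonempty domain, as is customary in first-order logic. For a $\Sigma$-structure $A$ and a formula $\phi$, $A\models\phi$ means that $\phi$ is satisfied in $A$ under every assignment of elements of $A$ to its free variables. Atomic formulas are also called identities. A class $\mathcal{K}$ of $\Sigma$-structures is a variety if there is a set $\Gamma$ of identities (over $\Sigma$) such that $\mathcal{K}$ is the class of all $\Sigma$-structures satisfying every formula in $\Gamma$. A homomorphism is a map commuting with the interpretations of function symbols and preserving (not necessarily reflecting) relations; a homomorphic image of $A$ is a structure $B$ for which there is a surjective homomorphism $A\to B$. The product $\prod_{i\in I}A_i$ of a set-indexed family of $\Sigma$-structures has functions computed coordinatewise, and a relation holds in it iff it holds in every coordinate. The index set $I$ may be empty, in which case the (trivial) product is a unit, i.e. a one-element structure in which all relations hold. (Since choice is not assumed, the Cartesian product of nonempty sets might be empty; products are considered only when it is nonempty.) $\mathcal{K}$ is closed under homomorphic images (substructures, products) if every homomorphic image of a member of $\mathcal{K}$ (every substructure of a member of $\mathcal{K}$, every product of a family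 of members of $\mathcal{K}$) belongs to $\mathcal{K}$. *)

theory Defs
  imports Main
begin

text \<open>
  The claim is a theorem (schema) of ZF. It is rendered as a statement about an arbitrary model
  of first-order ZF: \<open>mem\<close> is the membership relation of the model, whose elements
  form the type \<open>'v\<close>. Separation and Replacement range only over properties given by
  formulas of the language of set theory (with parameters), and a class is a subset of the model
  given by such a formula. Hence a choice function obtained in the metalogic need not be an element
  of the model or a class, and no form of choice is available inside the model.

  Signatures, structures, natural numbers, terms and identities are all those of the model. In the
  definitions below, every quantifier ranges over elements of the model, so that each defined notion
  is the interpretation of a first-order formula of set theory. By the completeness theorem,
  validity in all models of ZF is the same as provability in ZF.
\<close>

section \<open>Models of ZF\<close>

datatype fm = Mem nat nat | Eq nat nat | Neg fm | Conj fm fm | All nat fm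

primrec sat :: "('v \<Rightarrow> 'v \<Rightarrow> bool) \<Rightarrow> fm \<Rightarrow> (nat \<Rightarrow> 'v) \<Rightarrow> bool" where
  "sat E (Mem i j) e \<longleftrightarrow> E (e i) (e j)"
| "sat E (Eq i j) e \<longleftrightarrow> e i = e j"
| "sat E (Neg p) e \<longleftrightarrow> \<not> sat E p e"
| "sat E (Conj p q) e \<longleftrightarrow> sat E p e \<and> sat E q e"
| "sat E (All i p) e \<longleftrightarrow> (\<forall>x. sat E p (e(i := x)))"

text \<open>In Separation and Replacement, the values of \<open>e\<close> at the remaining variables are
  the parameters.\<close>

class zf =
  fixes mem :: "'a \<Rightarrow> 'a \<Rightarrow> bool" (infix "\<^bold>\<in>" 50)
  assumes extensionality: "\<forall>z. z \<^bold>\<in> x \<longleftrightarrow> z \<^bold>\<in> y \<Longrightarrow> x = y"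
    and foundation: "\<exists>z. z \<^bold>\<in> x \<Longrightarrow> \<exists>y. y \<^bold>\<in> x \<and> \<not> (\<exists>z. z \<^bold>\<in> x \<and> z \<^bold>\<in> y)"
    and pairing: "\<exists>u. x \<^bold>\<in> u \<and> y \<^bold>\<in> u"
    and union: "\<exists>u. \<forall>y z. z \<^bold>\<in> y \<and> y \<^bold>\<in> x \<longrightarrow> z \<^bold>\<in> u"
    and power_set: "\<exists>u. \<forall>z. (\<forall>w. w \<^bold>\<in> z \<longrightarrow> w \<^bold>\<in> x) \<longrightarrow> z \<^bold>\<in> u"
    and infinity: "\<exists>u. (\<exists>z. z \<^bold>\<in> u \<and> (\<forall>w. \<not> w \<^bold>\<in> z)) \<and>
                       (\<forall>x. x \<^bold>\<in> u \<longrightarrow> (\<exists>y. y \<^bold>\<in> u \<and> (\<forall>w. w \<^bold>\<in> y \<longleftrightarrow> w \<^bold>\<in> x \<or> w = x)))"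
    and separation: "\<exists>u. \<forall>z. z \<^bold>\<in> u \<longleftrightarrow> z \<^bold>\<in> x \<and> sat mem p (e(0 := z))"
    and replacement:
      "\<forall>z y y'. z \<^bold>\<in> x \<and> sat mem p (e(0 := z, 1 := y)) \<and> sat mem p (e(0 := z, 1 := y')) \<longrightarrow> y = y'
       \<Longrightarrow> \<exists>u. \<forall>y. y \<^bold>\<in> u \<longleftrightarrow> (\<exists>z. z \<^bold>\<in> x \<and> sat mem p (e(0 := z, 1 := y)))"

definition is_class :: "'v::zf set \<Rightarrow> bool" where
  "is_class K \<longleftrightarrow> (\<exists>p e. K = {x. sat mem p (e(0 := x))})"


section \<open>Set-theoretic vocabulary inside the model\<close>

definition elts :: "'v::zf \<Rightarrow> 'v set" where
  "elts x = {z. z \<^bold>\<in> x}"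

text \<open>Meaningful only if the model has a set with exactly the given elements; below it is only
  applied where ZF proves this.\<close>

definition setof :: "'v::zf set \<Rightarrow> 'v" where
  "setof X = (THE x. elts x = X)"

definition opair :: "'v::zf \<Rightarrow> 'v \<Rightarrow> 'v" where
  "opair x y = setof {setof {x}, setof {x, y}}"

definition succ :: "'v::zf \<Rightarrow> 'v" where
  "succ x = setof (insert x (elts x))"

definition omega :: "'v::zf" where
  "omega = setof {n. \<forall>w. setof {} \<in> elts w \<and> (\<forall>k\<in>elts w. succ k \<in> elts w) \<longrightarrow> n \<in> elts w}"

definition fun_on :: "'v::zf \<Rightarrow> 'v \<Rightarrow> bool" where
  "fun_on f a \<longleftrightarrow> (\<forall>p\<in>elts f. \<exists>x\<in>elts a. \<exists>y. p = opair x y) \<and>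
                 (\<forall>x\<in>elts a. \<exists>!y. opair x y \<in> elts f)"

definition app :: "'v::zf \<Rightarrow> 'v \<Rightarrow> 'v" where
  "app f x = (THE y. opair x y \<in> elts f)"

definition lam :: "'v::zf \<Rightarrow> ('v \<Rightarrow> 'v) \<Rightarrow> 'v" where
  "lam a F = setof {opair x (F x) | x. x \<in> elts a}"

definition func :: "'v::zf \<Rightarrow> 'v \<Rightarrow> 'v \<Rightarrow> bool" where
  "func f a b \<longleftrightarrow> fun_on f a \<and> (\<forall>x\<in>elts a. app f x \<in> elts b)"

text \<open>Natural numbers are von Neumann numerals, so \<open>funs n b\<close> is also the set of
  \<open>n\<close>-tuples over \<open>b\<close>.\<close>

definition funs :: "'v::zf \<Rightarrow> 'v \<Rightarrow> 'v" where
  "funs a b = setof {f. func f a b}"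


section \<open>Signatures and structures\<close>

record 'v signature =
  rels :: 'v
  funcs :: 'v
  arity :: 'v

definition is_signature :: "'v::zf signature \<Rightarrow> bool" where
  "is_signature \<Sigma> \<longleftrightarrow> elts (rels \<Sigma>) \<inter> elts (funcs \<Sigma>) = {} \<and>
                    func (arity \<Sigma>) (setof (elts (rels \<Sigma>) \<union> elts (funcs \<Sigma>))) omega"

abbreviation ar :: "'v::zf signature \<Rightarrow> 'v \<Rightarrow> 'v" where
  "ar \<Sigma> c \<equiv> app (arity \<Sigma>) c"

text \<open>A structure is a pair of its domain and the function assigning to each symbol its
  interpretation.\<close>

definition univ :: "'v::zf \<Rightarrow> 'v" where
  "univ M = (THE a. \<exists>i. M = opair a i)"

definition interp :: "'v::zf \<Rightarrow> 'v \<Rightarrow> 'v" where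
  "interp M c = app (THE i. \<exists>a. M = opair a i) c"

definition is_struct :: "'v::zf signature \<Rightarrow> 'v \<Rightarrow> bool" where
  "is_struct \<Sigma> M \<longleftrightarrow>
     (\<exists>a i. M = opair a i \<and> fun_on i (setof (elts (rels \<Sigma>) \<union> elts (funcs \<Sigma>)))) \<and>
     elts (univ M) \<noteq> {} \<and>
     (\<forall>f\<in>elts (funcs \<Sigma>). func (interp M f) (funs (ar \<Sigma> f) (univ M)) (univ M)) \<and>
     (\<forall>r\<in>elts (rels \<Sigma>). elts (interp M r) \<subseteq> elts (funs (ar \<Sigma> r) (univ M)))"

definition is_hom :: "'v::zf signature \<Rightarrow> 'v \<Rightarrow> 'v \<Rightarrow> 'v \<Rightarrow> bool" where
  "is_hom \<Sigma> h A B \<longleftrightarrow>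
     func h (univ A) (univ B) \<and>
     (\<forall>f\<in>elts (funcs \<Sigma>). \<forall>s\<in>elts (funs (ar \<Sigma> f) (univ A)).
        app h (app (interp A f) s) = app (interp B f) (lam (ar \<Sigma> f) (\<lambda>k. app h (app s k)))) \<and>
     (\<forall>r\<in>elts (rels \<Sigma>). \<forall>s\<in>elts (interp A r).
        lam (ar \<Sigma> r) (\<lambda>k. app h (app s k)) \<in> elts (interp B r))"

definition is_hom_image :: "'v::zf signature \<Rightarrow> 'v \<Rightarrow> 'v \<Rightarrow> bool" where
  "is_hom_image \<Sigma> B A \<longleftrightarrow> is_struct \<Sigma> A \<and> is_struct \<Sigma> B \<and>
     (\<exists>h. is_hom \<Sigma> h A B \<and> (\<forall>b\<in>elts (univ B). \<exists>a\<in>elts (univ A). app h a = b))"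

definition is_substruct :: "'v::zf signature \<Rightarrow> 'v \<Rightarrow> 'v \<Rightarrow> bool" where
  "is_substruct \<Sigma> B A \<longleftrightarrow> is_struct \<Sigma> A \<and> is_struct \<Sigma> B \<and>
     elts (univ B) \<subseteq> elts (univ A) \<and>
     (\<forall>f\<in>elts (funcs \<Sigma>). \<forall>s\<in>elts (funs (ar \<Sigma> f) (univ B)).
        app (interp B f) s = app (interp A f) s) \<and>
     (\<forall>r\<in>elts (rels \<Sigma>). \<forall>s\<in>elts (funs (ar \<Sigma> r) (univ B)).
        s \<in> elts (interp B r) \<longleftrightarrow> s \<in> elts (interp A r))"

text \<open>\<open>P\<close> is the product of the family \<open>(G(i))\<close>, \<open>i\<close> in \<open>I\<close>, and
  \<open>coord\<close> takes the \<open>i\<close>-th coordinates of an \<open>n\<close>-tuple of elements of the product.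
  Requiring \<open>P\<close> to be a structure restricts attention to nonempty products.\<close>

definition coord :: "'v::zf \<Rightarrow> 'v \<Rightarrow> 'v \<Rightarrow> 'v" where
  "coord n s i = lam n (\<lambda>k. app (app s k) i)"

definition is_product :: "'v::zf signature \<Rightarrow> 'v \<Rightarrow> 'v \<Rightarrow> 'v \<Rightarrow> bool" where
  "is_product \<Sigma> I G P \<longleftrightarrow>
     fun_on G I \<and> (\<forall>i\<in>elts I. is_struct \<Sigma> (app G i)) \<and> is_struct \<Sigma> P \<and>
     elts (univ P) = {x. fun_on x I \<and> (\<forall>i\<in>elts I. app x i \<in> elts (univ (app G i)))} \<and>
     (\<forall>f\<in>elts (funcs \<Sigma>). \<forall>s\<in>elts (funs (ar \<Sigma> f) (univ P)).
        app (interp P f) s = lam I (\<lambda>i. app (interp (app G i) f) (coord (ar \<Sigma> f) s i))) \<and>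
     (\<forall>r\<in>elts (rels \<Sigma>). \<forall>s\<in>elts (funs (ar \<Sigma> r) (univ P)).
        s \<in> elts (interp P r) \<longleftrightarrow>
        (\<forall>i\<in>elts I. coord (ar \<Sigma> r) s i \<in> elts (interp (app G i) r)))"

definition closed_hom_images :: "'v::zf signature \<Rightarrow> 'v set \<Rightarrow> bool" where
  "closed_hom_images \<Sigma> K \<longleftrightarrow> (\<forall>A\<in>K. \<forall>B. is_hom_image \<Sigma> B A \<longrightarrow> B \<in> K)"

definition closed_substructs :: "'v::zf signature \<Rightarrow> 'v set \<Rightarrow> bool" where
  "closed_substructs \<Sigma> K \<longleftrightarrow> (\<forall>A\<in>K. \<forall>B. is_substruct \<Sigma> B A \<longrightarrow> B \<in> K)"

definition closed_products :: "'v::zf signature \<Rightarrow> 'v set \<Rightarrow> bool" where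
  "closed_products \<Sigma> K \<longleftrightarrow>
     (\<forall>I G P. (\<forall>i\<in>elts I. app G i \<in> K) \<and> is_product \<Sigma> I G P \<longrightarrow> P \<in> K)"


section \<open>Terms and identities\<close>

text \<open>Terms are coded as sets of the model: the variable with index \<open>x\<close> as \<open>(0, x)\<close>,
  and the application of \<open>f\<close> to the tuple \<open>s\<close> of terms as \<open>(1, (f, s))\<close>.
  \<open>terms \<Sigma> X\<close> is the least set containing the variables with indices in \<open>X\<close>
  and closed under application. Identities use the variables indexed by \<open>omega\<close>.\<close>

definition tvar :: "'v::zf \<Rightarrow> 'v" where
  "tvar x = opair (setof {}) x"

definition tapp :: "'v::zf \<Rightarrow> 'v \<Rightarrow> 'v" where
  "tapp f s = opair (succ (setof {})) (opair f s)"

definition term_closed :: "'v::zf signature \<Rightarrow> 'v \<Rightarrow> 'v \<Rightarrow> bool" where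
  "term_closed \<Sigma> X T \<longleftrightarrow>
     (\<forall>x\<in>elts X. tvar x \<in> elts T) \<and>
     (\<forall>f\<in>elts (funcs \<Sigma>). \<forall>s\<in>elts (funs (ar \<Sigma> f) T). tapp f s \<in> elts T)"

definition terms :: "'v::zf signature \<Rightarrow> 'v \<Rightarrow> 'v" where
  "terms \<Sigma> X = setof {t. \<forall>T. term_closed \<Sigma> X T \<longrightarrow> t \<in> elts T}"

definition is_eval :: "'v::zf signature \<Rightarrow> 'v \<Rightarrow> 'v \<Rightarrow> 'v \<Rightarrow> 'v \<Rightarrow> bool" where
  "is_eval \<Sigma> X A v h \<longleftrightarrow>
     func h (terms \<Sigma> X) (univ A) \<and>
     (\<forall>x\<in>elts X. app h (tvar x) = app v x) \<and>
     (\<forall>f\<in>elts (funcs \<Sigma>). \<forall>s\<in>elts (funs (ar \<Sigma> f) (terms \<Sigma> X)).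
        app h (tapp f s) = app (interp A f) (lam (ar \<Sigma> f) (\<lambda>k. app h (app s k))))"

text \<open>The value of the term \<open>t\<close> in \<open>A\<close> under the assignment \<open>v\<close>.\<close>

definition eval :: "'v::zf signature \<Rightarrow> 'v \<Rightarrow> 'v \<Rightarrow> 'v \<Rightarrow> 'v \<Rightarrow> 'v" where
  "eval \<Sigma> X A v t = app (THE h. is_eval \<Sigma> X A v h) t"

definition eqn :: "'v::zf \<Rightarrow> 'v \<Rightarrow> 'v" where
  "eqn t u = opair (setof {}) (opair t u)"

definition relatom :: "'v::zf \<Rightarrow> 'v \<Rightarrow> 'v" where
  "relatom r s = opair (succ (setof {})) (opair r s)"

definition is_identity :: "'v::zf signature \<Rightarrow> 'v \<Rightarrow> bool" where
  "is_identity \<Sigma> p \<longleftrightarrow>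
     (\<exists>t\<in>elts (terms \<Sigma> omega). \<exists>u\<in>elts (terms \<Sigma> omega). p = eqn t u) \<or>
     (\<exists>r\<in>elts (rels \<Sigma>). \<exists>s\<in>elts (funs (ar \<Sigma> r) (terms \<Sigma> omega)). p = relatom r s)"

definition sat_identity :: "'v::zf signature \<Rightarrow> 'v \<Rightarrow> 'v \<Rightarrow> 'v \<Rightarrow> bool" where
  "sat_identity \<Sigma> A v p \<longleftrightarrow>
     (\<exists>t u. p = eqn t u \<and> eval \<Sigma> omega A v t = eval \<Sigma> omega A v u) \<or>
     (\<exists>r s. p = relatom r s \<and>
        lam (ar \<Sigma> r) (\<lambda>k. eval \<Sigma> omega A v (app s k)) \<in> elts (interp A r))"

definition models :: "'v::zf signature \<Rightarrow> 'v \<Rightarrow> 'v \<Rightarrow> bool" where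
  "models \<Sigma> A p \<longleftrightarrow> (\<forall>v. func v omega (univ A) \<longrightarrow> sat_identity \<Sigma> A v p)"

definition is_variety :: "'v::zf signature \<Rightarrow> 'v set \<Rightarrow> bool" where
  "is_variety \<Sigma> K \<longleftrightarrow>
     (\<exists>\<Gamma>. (\<forall>p\<in>elts \<Gamma>. is_identity \<Sigma> p) \<and>
          K = {A. is_struct \<Sigma> A \<and> (\<forall>p\<in>elts \<Gamma>. models \<Sigma> A p)})"

end

theory Submission
  imports Defs
begin

text \<open>
  Let \<open>K\<close> be closed under homomorphic images, substructures and products. For every nonempty set
  \<open>X\<close> there is a structure \<open>F(X)\<close> in \<open>K\<close>, generated by \<open>X\<close>, such that every map from \<open>X\<close> to a
  member of \<open>K\<close> extends to a homomorphism. It is the substructure generated by the diagonal in the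
  product over \<^emph>\<open>all\<close> pairs of a suitably bounded member \<open>B\<close> of \<open>K\<close> and a map from \<open>X\<close> to \<open>B\<close>, so
  nothing has to be chosen. As identities, take those that hold of the generators in \<open>F(omega)\<close>.
  If a structure \<open>A\<close> satisfies them, then \<open>F(A)\<close> maps homomorphically onto \<open>A\<close>: an equation or
  relation between terms involves finitely many elements of \<open>A\<close>, and these can be renamed to
  variables in \<open>omega\<close>. The remaining choices, in particular those in the proof that identities are
  preserved under homomorphic images, concern finitely many sets.
\<close>

section \<open>Definable predicates\<close>

text \<open>The axiom schemas of the model cover only properties given by formulas with parameters.
  Every set, function, induction and recursion therefore has to come with a proof of definability.
  The calculus of \<open>definable\<close> and \<open>definable_term\<close>, with its rule
  collection \<open>dfn\<close>, makes most of these proofs mechanical. Free structures over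
  arbitrary sets of generators are needed because identities have variables from
  \<open>omega\<close> only: a structure need not be generated by countably many elements, and then
  it is no image of F(omega). Without choice, even the existence of the product is in question,
  since a product of nonempty sets might be empty; the diagonal supplies explicit elements. The
  bound on its factors comes from the power set of the set of terms, so no term has to be selected
  to represent an element. Finite arities matter twice. They confine each identity to finitely many
  variables, and they reduce lifting a tuple along a surjection to choices that induction on
  \<open>omega\<close> provides.\<close>

primrec ren :: "(nat \<Rightarrow> nat) \<Rightarrow> fm \<Rightarrow> fm" where
  "ren \<sigma> (Mem i j) = Mem (\<sigma> i) (\<sigma> j)"
| "ren \<sigma> (Eq i j) = Eq (\<sigma> i) (\<sigma> j)"
| "ren \<sigma> (Neg p) = Neg (ren \<sigma> p)"
| "ren \<sigma> (Conj p q) = Conj (ren \<sigma> p) (ren \<sigma> q)"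
| "ren \<sigma> (All i p) = All (\<sigma> i) (ren \<sigma> p)"

text \<open>Injectivity rules out capture: updating the value at \<open>\<sigma> i\<close> must not
  change that of any other renamed variable.\<close>

lemma sat_ren:
  assumes "inj \<sigma>"
  shows "sat E (ren \<sigma> p) e \<longleftrightarrow> sat E p (e \<circ> \<sigma>)"
proof (induction p arbitrary: e)
  case (All i p)
  have "(e(\<sigma> i := x)) \<circ> \<sigma> = (e \<circ> \<sigma>)(i := x)" for x
    using assms by (auto simp: fun_eq_iff inj_eq)
  then show ?case by (simp add: All del: comp_apply fun_upd_apply)
qed auto

text \<open>Even positions hold the arguments of a predicate and odd positions its parameters.\<close>

definition mix :: "(nat \<Rightarrow> 'v) \<Rightarrow> (nat \<Rightarrow> 'v) \<Rightarrow> nat \<Rightarrow> 'v" where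
  "mix e c n = (if even n then e (n div 2) else c (n div 2))"

definition definable :: "((nat \<Rightarrow> 'v::zf) \<Rightarrow> bool) \<Rightarrow> bool" where
  "definable P \<longleftrightarrow> (\<exists>p c. \<forall>e. P e \<longleftrightarrow> sat mem p (mix e c))"

text \<open>Environments are read as de Bruijn contexts: index \<open>0\<close> is the innermost bound variable.
  Quantifier rules then have higher-order patterns as conclusions, so that \<open>intro\<close> can apply them.\<close>

definition definable_term :: "((nat \<Rightarrow> 'v::zf) \<Rightarrow> 'v) \<Rightarrow> bool" where
  "definable_term t \<longleftrightarrow> definable (\<lambda>e. e 0 = t (\<lambda>n. e (Suc n)))"

named_theorems dfn

lemma definableI: "(\<And>e. P e \<longleftrightarrow> sat mem p (mix e c)) \<Longrightarrow> definable P"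
  unfolding definable_def by blast

text \<open>Only arguments move, while parameters stay in place. With suitable
  \<open>\<sigma>\<close> this gives weakening and exchange for the de Bruijn contexts.\<close>

lemma definable_rename:
  assumes "definable P" "inj \<sigma>"
  shows "definable (\<lambda>e. P (\<lambda>n. e (\<sigma> n)))"
proof -
  obtain p c where p: "\<And>e. P e \<longleftrightarrow> sat mem p (mix e c)" using assms(1) unfolding definable_def by blast
  let ?s = "\<lambda>n. if even n then 2 * \<sigma> (n div 2) else n"
  have "inj ?s"
  proof (rule injI)
    fix x y assume "?s x = ?s y"
    then show "x = y"
      using injD[OF assms(2), of "x div 2" "y div 2"] by (auto split: if_splits elim!: evenE)
  qed
  moreover have "mix e c \<circ> ?s = mix (\<lambda>n. e (\<sigma> n)) c" for e
    by (auto simp: mix_def fun_eq_iff)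
  ultimately show ?thesis by (intro definableI[of _ "ren ?s p" c]) (simp add: sat_ren p)
qed

lemma definable_not[dfn]: "definable P \<Longrightarrow> definable (\<lambda>e. \<not> P e)"
  unfolding definable_def by (metis sat.simps(3))

lemma definable_conj[dfn]:
  assumes "definable P" "definable Q"
  shows "definable (\<lambda>e. P e \<and> Q e)"
proof -
  obtain p c where p: "\<And>e. P e \<longleftrightarrow> sat mem p (mix e c)" using assms(1) unfolding definable_def by blast
  obtain q d where q: "\<And>e. Q e \<longleftrightarrow> sat mem q (mix e d)" using assms(2) unfolding definable_def by blast
  \<comment> \<open>The two formulas bring separate parameter lists. Parameter \<open>k\<close>,
    formerly at position \<open>2k + 1\<close>, moves to \<open>4k + 1\<close> for \<open>p\<close>
    and to \<open>4k + 3\<close> for \<open>q\<close>, which is where \<open>mix c d\<close> stores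
    it.\<close>
  let ?s = "\<lambda>n::nat. if even n then n else 2 * n - 1"
  let ?r = "\<lambda>n::nat. if even n then n else 2 * n + 1"
  have "inj ?s"
    by (rule inj_on_inverseI[of _ "\<lambda>n. if even n then n else (n + 1) div 2"]) (auto elim!: oddE)
  moreover have "inj ?r"
    by (rule inj_on_inverseI[of _ "\<lambda>n. if even n then n else (n - 1) div 2"]) auto
  moreover have "mix e (mix c d) \<circ> ?s = mix e c" "mix e (mix c d) \<circ> ?r = mix e d" for e
    by (auto simp: mix_def fun_eq_iff double_not_eq_Suc_double Suc_double_not_eq_double elim!: oddE)
  ultimately show ?thesis
    by (intro definableI[of _ "Conj (ren ?s p) (ren ?r q)" "mix c d"]) (simp add: sat_ren p q)
qed

text \<open>The position of parameter \<open>0\<close> is freed for the bound variable.\<close>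

lemma definable_all[dfn]:
  assumes "definable (\<lambda>e. P (e 0) (\<lambda>n. e (Suc n)))"
  shows "definable (\<lambda>e. \<forall>x. P x e)"
proof -
  obtain p c where p: "\<And>e. P (e 0) (\<lambda>n. e (Suc n)) \<longleftrightarrow> sat mem p (mix e c)"
    using assms unfolding definable_def by blast
  let ?s = "\<lambda>n. if n = 0 then 1 else if even n then n - 2 else n + (2::nat)"
  let ?c = "\<lambda>n. c (n - 1)"
  have inj: "inj ?s"
    by (rule inj_on_inverseI[of _ "\<lambda>n. if n = 1 then 0 else if even n then n + 2 else n - 2"])
      (auto, presburger)
  have eq: "(mix e ?c)(1 := x) \<circ> ?s = mix (\<lambda>n. case n of 0 \<Rightarrow> x | Suc m \<Rightarrow> e m) c" for e x
    by (auto simp: mix_def fun_eq_iff elim!: evenE oddE split: nat.split)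
  have "P x e \<longleftrightarrow> sat mem (ren ?s p) ((mix e ?c)(1 := x))" for x e
    unfolding sat_ren[OF inj] eq using p[of "\<lambda>n. case n of 0 \<Rightarrow> x | Suc m \<Rightarrow> e m"] by simp
  then show ?thesis by (intro definableI[of _ "All 1 (ren ?s p)" ?c]) simp
qed

lemma definable_disj[dfn]:
  assumes "definable P" "definable Q"
  shows "definable (\<lambda>e. P e \<or> Q e)"
proof -
  have "definable (\<lambda>e. \<not> (\<not> P e \<and> \<not> Q e))" by (rule definable_not, rule definable_conj; rule definable_not, rule assms)
  then show ?thesis by simp
qed

lemma definable_imp[dfn]:
  assumes "definable P" "definable Q"
  shows "definable (\<lambda>e. P e \<longrightarrow> Q e)"
proof -
  have "definable (\<lambda>e. \<not> P e \<or> Q e)" by (rule definable_disj, rule definable_not, rule assms, rule assms)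
  then show ?thesis by simp
qed

lemma definable_iff[dfn]:
  assumes "definable P" "definable Q"
  shows "definable (\<lambda>e. P e \<longleftrightarrow> Q e)"
proof -
  have "definable (\<lambda>e. (P e \<longrightarrow> Q e) \<and> (Q e \<longrightarrow> P e))" by (rule definable_conj; rule definable_imp; rule assms)
  moreover have "(\<lambda>e. P e \<longleftrightarrow> Q e) = (\<lambda>e. (P e \<longrightarrow> Q e) \<and> (Q e \<longrightarrow> P e))" by blast
  ultimately show ?thesis by simp
qed

lemma definable_ex[dfn]:
  assumes "definable (\<lambda>e. P (e 0) (\<lambda>n. e (Suc n)))"
  shows "definable (\<lambda>e. \<exists>x. P x e)"
proof -
  have "definable (\<lambda>e. \<not> (\<forall>x. \<not> P x e))" by (rule definable_not, rule definable_all, rule definable_not, rule assms)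
  then show ?thesis by simp
qed

lemma definable_eq_var: "definable (\<lambda>e. e i = e j)"
  by (rule definableI[of _ "Eq (2 * i) (2 * j)"]) (simp add: mix_def)

lemma definable_mem_var: "definable (\<lambda>e. e i \<^bold>\<in> e j)"
  by (rule definableI[of _ "Mem (2 * i) (2 * j)"]) (simp add: mix_def)

lemma definable_True: "definable (\<lambda>e. True)"
  using definable_eq_var[of 0 0] by simp

lemma definable_const[dfn]: "definable (\<lambda>e. P)"
  using definable_True definable_not[OF definable_True] by (cases P) simp_all

lemma definable_term_var[dfn]: "definable_term (\<lambda>e. e i)"
  unfolding definable_term_def by (rule definable_eq_var)

lemma definable_term_const[dfn]: "definable_term (\<lambda>e. c)"
  unfolding definable_term_def by (rule definableI[of _ "Eq 0 1" "\<lambda>_. c"]) (simp add: mix_def)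

lemma definable_subst:
  assumes "definable (\<lambda>e. P (e 0) (\<lambda>n. e (Suc n)))" "definable_term t"
  shows "definable (\<lambda>e. P (t e) e)"
proof -
  have "definable (\<lambda>e. e 0 = t (\<lambda>n. e (Suc n)) \<and> P (e 0) (\<lambda>n. e (Suc n)))"
    using assms unfolding definable_term_def by (intro definable_conj)
  from definable_ex[OF this] show ?thesis by simp
qed

lemma definable_term_weaken: "definable_term t \<Longrightarrow> definable_term (\<lambda>e. t (\<lambda>n. e (Suc n)))"
  unfolding definable_term_def
  using definable_rename[of "\<lambda>e. e 0 = t (\<lambda>n. e (Suc n))" "\<lambda>n. if n = 0 then 0 else Suc n"]
  by (auto simp: inj_def)

lemma definable_subst2:
  assumes "definable (\<lambda>e. P (e 0) (e (Suc 0)))" "definable_term t" "definable_term s"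
  shows "definable (\<lambda>e. P (t e) (s e))"
proof -
  have "definable (\<lambda>e. P (t (\<lambda>n. e (Suc n))) (e 0))"
    by (rule definable_subst[of "\<lambda>x e. P x (e 0)", OF _ definable_term_weaken[OF assms(2)]]) (rule assms)
  from definable_subst[of "\<lambda>x e. P (t e) x", OF this assms(3)] show ?thesis .
qed

lemma definable_eq[dfn]: "definable_term t \<Longrightarrow> definable_term s \<Longrightarrow> definable (\<lambda>e. t e = s e)"
  by (rule definable_subst2[of "(=)"]) (rule definable_eq_var)

lemma definable_elts[dfn]: "definable_term t \<Longrightarrow> definable_term s \<Longrightarrow> definable (\<lambda>e. t e \<in> elts (s e))"
  unfolding elts_def by (simp, rule definable_subst2[of mem]) (rule definable_mem_var)

lemma definable_Ball[dfn]:
  assumes "definable_term a" "definable (\<lambda>e. P (e 0) (\<lambda>n. e (Suc n)))"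
  shows "definable (\<lambda>e. \<forall>x\<in>elts (a e). P x e)"
  unfolding Ball_def by (intro definable_all definable_imp definable_elts definable_term_var definable_term_weaken[OF assms(1)] assms(2))

lemma definable_Bex[dfn]:
  assumes "definable_term a" "definable (\<lambda>e. P (e 0) (\<lambda>n. e (Suc n)))"
  shows "definable (\<lambda>e. \<exists>x\<in>elts (a e). P x e)"
  unfolding Bex_def by (intro definable_ex definable_conj definable_elts definable_term_var definable_term_weaken[OF assms(1)] assms(2))

lemma definable_class:
  assumes "is_class K"
  shows "definable_term t \<Longrightarrow> definable (\<lambda>e. t e \<in> K)"
proof -
  obtain p e0 where K: "K = {x. sat mem p (e0(0 := x))}" using assms unfolding is_class_def by blast
  \<comment> \<open>Variable 0 of the class formula is the argument and keeps its position; all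
    others are parameters and move to odd positions.\<close>
  let ?s = "\<lambda>n. case n of 0 \<Rightarrow> 0 | Suc m \<Rightarrow> 2 * m + (1::nat)"
  have inj: "inj ?s" by (auto intro!: injI split: nat.splits)
  have "mix e (\<lambda>n. e0 (Suc n)) \<circ> ?s = e0(0 := e 0)" for e
    by (auto simp: mix_def fun_eq_iff split: nat.split)
  then have "definable (\<lambda>e. e 0 \<in> K)"
    by (intro definableI[of _ "ren ?s p" "\<lambda>n. e0 (Suc n)"]) (simp add: sat_ren[OF inj] K)
  then show "definable_term t \<Longrightarrow> definable (\<lambda>e. t e \<in> K)" by (rule definable_subst[of "\<lambda>x e. x \<in> K"])
qed

lemma definable_singleton[dfn]: "definable_term t \<Longrightarrow> definable_term s \<Longrightarrow> definable (\<lambda>e. t e \<in> insert (s e) {})"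
  by (simp add: definable_eq)

lemma definable_insert[dfn]: "definable_term t \<Longrightarrow> definable_term s \<Longrightarrow> definable (\<lambda>e. t e \<in> S e) \<Longrightarrow> definable (\<lambda>e. t e \<in> insert (s e) (S e))"
  unfolding insert_iff by (intro dfn)

lemma definable_Collect[dfn]: "definable (\<lambda>e. P (t e) e) \<Longrightarrow> definable (\<lambda>e. t e \<in> {x. P x e})"
  by simp

text \<open>\<open>THE\<close> is unspecified when it fails. With at most one witness, failure means
  that there is none, and the value is then always the constant \<open>THE x. False\<close>, which
  can serve as a parameter.\<close>

lemma definable_term_the:
  assumes "definable (\<lambda>e. P (e 0) (\<lambda>n. e (Suc n)))" "\<And>e x y. P x e \<Longrightarrow> P y e \<Longrightarrow> x = y"
  shows "definable_term (\<lambda>e. THE x. P x e)"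
proof -
  have eq: "y = (THE x. P x e) \<longleftrightarrow> P y e \<or> (\<forall>x. \<not> P x e) \<and> y = (THE x. False)" for y e
  proof (cases "\<exists>x. P x e")
    case True
    then obtain x where x: "P x e" by blast
    then have "(THE x. P x e) = x" using assms(2) by (intro the_equality)
    then show ?thesis using x assms(2) by blast
  qed simp
  have "definable (\<lambda>e. P (e (Suc 0)) (\<lambda>n. e (Suc (Suc n))))"
    using definable_rename[OF assms(1), of Suc] by simp
  moreover have "definable (\<lambda>e. P (e 0) (\<lambda>n. e (Suc (Suc n))))"
    using definable_rename[OF assms(1), of "\<lambda>n. if n = 0 then 0 else Suc n"] by (auto simp: inj_def)
  ultimately show ?thesis
    unfolding definable_term_def eq by (intro dfn assms(1))
qed

lemma definable_term_if:
  assumes "definable P" "definable_term t" "definable_term s"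
  shows "definable_term (\<lambda>e. if P e then t e else s e)"
proof -
  have "definable (\<lambda>e. P (\<lambda>n. e (Suc n)))" using definable_rename[OF assms(1), of Suc] by simp
  then have "definable (\<lambda>e. P (\<lambda>n. e (Suc n)) \<and> e 0 = t (\<lambda>n. e (Suc n)) \<or>
      \<not> P (\<lambda>n. e (Suc n)) \<and> e 0 = s (\<lambda>n. e (Suc n)))"
    using assms(2,3) unfolding definable_term_def by (intro definable_disj definable_conj definable_not)
  moreover have "(\<lambda>e. P (\<lambda>n. e (Suc n)) \<and> e 0 = t (\<lambda>n. e (Suc n)) \<or>
      \<not> P (\<lambda>n. e (Suc n)) \<and> e 0 = s (\<lambda>n. e (Suc n))) =
    (\<lambda>e. e 0 = (if P (\<lambda>n. e (Suc n)) then t (\<lambda>n. e (Suc n)) else s (\<lambda>n. e (Suc n))))"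
    by auto
  ultimately show ?thesis unfolding definable_term_def by metis
qed

lemma elts_inject: "elts x = elts y \<Longrightarrow> x = y"
  by (rule extensionality) (auto simp: elts_def)

text \<open>Extensionality supplies the uniqueness required by \<open>definable_term_the\<close>,
  whether or not the set exists.\<close>

lemma definable_term_setof[dfn]:
  assumes "definable (\<lambda>e. e 0 \<in> S (\<lambda>n. e (Suc n)))"
  shows "definable_term (\<lambda>e. setof (S e))"
proof -
  have "definable (\<lambda>e. e 0 \<in> S (\<lambda>n. e (Suc (Suc n))))"
    using definable_rename[OF assms(1), of "\<lambda>n. if n = 0 then 0 else Suc n"] by (auto simp: inj_def)
  then have "definable (\<lambda>e. \<forall>z. z \<in> elts (e 0) \<longleftrightarrow> z \<in> S (\<lambda>n. e (Suc n)))"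
    by (intro definable_all definable_iff definable_elts definable_term_var)
  then have "definable_term (\<lambda>e. THE x. \<forall>z. z \<in> elts x \<longleftrightarrow> z \<in> S e)"
    by (rule definable_term_the) (auto intro: elts_inject)
  moreover have "setof (S e) = (THE x. \<forall>z. z \<in> elts x \<longleftrightarrow> z \<in> S e)" for e
    unfolding setof_def by (rule arg_cong[of _ _ The]) auto
  ultimately show ?thesis by simp
qed

section \<open>Separation and Replacement for definable predicates and terms\<close>

lemma separation_definable:
  assumes "definable (\<lambda>e. P (e 0))"
  shows "\<exists>u. elts u = {z \<in> elts x. P z}"
proof -
  obtain p c where p: "\<And>e. P (e 0) \<longleftrightarrow> sat mem p (mix e c)" using assms unfolding definable_def by blast
  have "(mix (\<lambda>_. x) c)(0 := z) = mix (\<lambda>n. if n = 0 then z else x) c" for z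
    by (auto simp: mix_def fun_eq_iff elim: evenE)
  then have "P z \<longleftrightarrow> sat mem p ((mix (\<lambda>_. x) c)(0 := z))" for z
    using p[of "\<lambda>n. if n = 0 then z else x"] by simp
  then show ?thesis using separation[of x p "mix (\<lambda>_. x) c"] by (auto simp: elts_def)
qed

lemma replacement_definable_term:
  assumes "definable_term (\<lambda>e. F (e 0))"
  shows "\<exists>u. elts u = F ` elts x"
proof -
  obtain p c where p: "\<And>e. e 0 = F (e (Suc 0)) \<longleftrightarrow> sat mem p (mix e c)"
    using assms unfolding definable_def definable_term_def by blast
  \<comment> \<open>Replacement reads the input at 0 and the output at 1, whereas \<open>p\<close>
    has the output at position 0 and the input at position 2. All other positions shift up by 2 to
    make room.\<close>
  let ?s = "\<lambda>n. if n = 0 then 1 else if n = 2 then 0 else n + (2::nat)"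
  let ?e = "\<lambda>n. mix (\<lambda>_. x) c (n - 2)"
  have inj: "inj ?s" by (auto intro!: injI split: if_splits)
  have eq: "?e(0 := z, 1 := y) \<circ> ?s = mix (\<lambda>n. if n = 0 then y else if n = 1 then z else x) c" for z y
    by (auto simp: mix_def fun_eq_iff elim: evenE)
  have F: "sat mem (ren ?s p) (?e(0 := z, 1 := y)) \<longleftrightarrow> y = F z" for y z
    unfolding sat_ren[OF inj] eq
    using p[of "\<lambda>n. if n = 0 then y else if n = 1 then z else x"] by simp
  have "\<exists>u. \<forall>y. y \<^bold>\<in> u \<longleftrightarrow> (\<exists>z. z \<^bold>\<in> x \<and> y = F z)"
    using replacement[of x "ren ?s p" ?e] unfolding F by blast
  then show ?thesis by (auto simp: elts_def image_def)
qed

section \<open>Set theory inside the model\<close>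

text \<open>A collection in the metalogic need not be a set of the model. The set existence axioms
  are restated as closure properties of this predicate, under which \<open>setof\<close> is
  meaningful.\<close>

definition isset :: "'v::zf set \<Rightarrow> bool" where
  "isset X \<longleftrightarrow> (\<exists>u. elts u = X)"

lemma elts_setof: "isset X \<Longrightarrow> elts (setof X) = X"
  unfolding isset_def setof_def by (metis (mono_tags, lifting) elts_inject theI)

lemma setof_elts[simp]: "setof (elts x) = x"
  using elts_setof[of "elts x"] by (auto simp: isset_def intro: elts_inject)

lemma isset_elts[simp]: "isset (elts x)"
  unfolding isset_def by blast

lemma isset_subset:
  assumes "isset Y" "definable (\<lambda>e. e 0 \<in> X)" "X \<subseteq> Y"
  shows "isset X"
proof -
  obtain u where "elts u = Y" using assms(1) isset_def by metis
  moreover obtain w where "elts w = {z \<in> elts u. z \<in> X}"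
    using separation_definable[of "\<lambda>z. z \<in> X"] assms(2) by metis
  ultimately show ?thesis using assms(3) unfolding isset_def by blast
qed

lemma isset_sep: "definable (\<lambda>e. P (e 0)) \<Longrightarrow> isset {z \<in> elts x. P z}"
  unfolding isset_def by (rule separation_definable)

lemma isset_image: "definable_term (\<lambda>e. F (e 0)) \<Longrightarrow> isset X \<Longrightarrow> isset (F ` X)"
  unfolding isset_def using replacement_definable_term by metis

lemma isset_empty[simp]: "isset {}"
  using isset_sep[of "\<lambda>_. False", OF definable_const] by simp

lemma elts_empty[simp]: "elts (setof {}) = {}"
  by (simp add: elts_setof)

lemma isset_pair[simp]: "isset {x, y}"
proof -
  obtain u where "x \<in> elts u" "y \<in> elts u" using pairing[of x y] by (auto simp: elts_def)
  then show ?thesis by (intro isset_subset[OF isset_elts[of u]]) (intro dfn, auto)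
qed

lemma isset_singleton[simp]: "isset {x}"
  using isset_pair[of x x] by simp

lemma isset_Union:
  assumes "isset X"
  shows "isset (\<Union>x\<in>X. elts x)"
proof -
  obtain a where a: "elts a = X" using assms isset_def by metis
  obtain u where "\<forall>y z. z \<^bold>\<in> y \<and> y \<^bold>\<in> a \<longrightarrow> z \<^bold>\<in> u" using union[of a] by blast
  then have "(\<Union>x\<in>elts a. elts x) \<subseteq> elts u" by (auto simp: elts_def)
  moreover have "definable (\<lambda>e. \<exists>x\<in>elts a. e 0 \<in> elts x)" by (intro dfn)
  ultimately show ?thesis unfolding a[symmetric] by (intro isset_subset[OF isset_elts[of u]]) simp_all
qed

lemma isset_Un[simp]: "isset X \<Longrightarrow> isset Y \<Longrightarrow> isset (X \<union> Y)"
  using isset_Union[of "{setof X, setof Y}"] by (simp add: elts_setof)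

lemma isset_insert[simp]: "isset X \<Longrightarrow> isset (insert x X)"
  using isset_Un[of "{x}" X] by simp

lemma isset_UN:
  assumes "definable_term (\<lambda>e. setof (B (e 0)))" "\<And>x. x \<in> X \<Longrightarrow> isset (B x)" "isset X"
  shows "isset (\<Union>x\<in>X. B x)"
  using isset_Union[OF isset_image[OF assms(1,3)]] assms(2) by (simp add: elts_setof)

lemma isset_Pow: "isset {z. elts z \<subseteq> elts x}"
proof -
  obtain u where "\<forall>z. (\<forall>w. w \<^bold>\<in> z \<longrightarrow> w \<^bold>\<in> x) \<longrightarrow> z \<^bold>\<in> u" using power_set[of x] by blast
  then have "{z. elts z \<subseteq> elts x} \<subseteq> elts u" by (auto simp: elts_def)
  moreover have "definable (\<lambda>e. \<forall>w\<in>elts (e 0). w \<in> elts x)" by (intro dfn)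
  ultimately show ?thesis by (intro isset_subset[OF isset_elts[of u]]) (simp_all add: subset_eq)
qed

lemma opair_inject[simp]: "opair x y = opair x' y' \<longleftrightarrow> x = x' \<and> y = y'"
proof
  assume "opair x y = opair x' y'"
  then have "elts ` elts (opair x y) = elts ` elts (opair x' y')" by simp
  then have "{{x}, {x, y}} = {{x'}, {x', y'}}" by (simp add: opair_def elts_setof)
  then show "x = x' \<and> y = y'" by (auto simp: doubleton_eq_iff)
qed simp

lemma definable_term_rename:
  assumes "definable_term t" "inj \<sigma>"
  shows "definable_term (\<lambda>e. t (\<lambda>n. e (\<sigma> n)))"
proof -
  have "inj (\<lambda>n. case n of 0 \<Rightarrow> 0 | Suc m \<Rightarrow> Suc (\<sigma> m))"
    using assms(2) by (auto intro!: injI simp: inj_eq split: nat.splits)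
  from definable_rename[OF assms(1)[unfolded definable_term_def] this] show ?thesis by (simp add: definable_term_def)
qed

lemma definable_term_subst:
  assumes "definable_term (\<lambda>e. F (e 0))" "definable_term t"
  shows "definable_term (\<lambda>e. F (t e))"
  unfolding definable_term_def
proof -
  have "definable (\<lambda>e. e (Suc 0) = F (e 0))"
    using definable_rename[OF assms(1)[unfolded definable_term_def], of "\<lambda>n. if n = 0 then 1 else if n = 1 then 0 else n"]
    by (auto simp: inj_def)
  from definable_subst[of "\<lambda>x e. e 0 = F x", OF _ definable_term_weaken[OF assms(2)]] this
  show "definable (\<lambda>e. e 0 = F (t (\<lambda>n. e (Suc n))))" by simp
qed

lemma definable_term_subst2:
  assumes "definable_term (\<lambda>e. F (e 0) (e (Suc 0)))" "definable_term t" "definable_term s"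
  shows "definable_term (\<lambda>e. F (t e) (s e))"
proof -
  let ?s = "\<lambda>n. if n = 0 then Suc (Suc 0) else if n = Suc 0 then Suc 0 else if n = Suc (Suc 0) then 0 else n"
  have "inj ?s" by (auto simp: inj_def)
  from definable_rename[OF assms(1)[unfolded definable_term_def] this]
  have "definable (\<lambda>e. e (Suc (Suc 0)) = F (e (Suc 0)) (e 0))" by simp
  then have "definable (\<lambda>e. \<exists>x y. x = t (\<lambda>n. e (Suc n)) \<and> y = s (\<lambda>n. e (Suc n)) \<and> e 0 = F x y)"
    by - (rule definable_ex, rule definable_ex, rule definable_conj,
      rule definable_eq[OF definable_term_var definable_term_weaken[OF definable_term_weaken[OF definable_term_weaken[OF assms(2)]]]], rule definable_conj,
      rule definable_eq[OF definable_term_var definable_term_weaken[OF definable_term_weaken[OF definable_term_weaken[OF assms(3)]]]])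
  then show ?thesis by (simp add: definable_term_def)
qed

lemma definable_term_opair[dfn]: "definable_term t \<Longrightarrow> definable_term s \<Longrightarrow> definable_term (\<lambda>e. opair (t e) (s e))"
  by (rule definable_term_subst2) (unfold opair_def, intro dfn)

lemma definable_subset[dfn]: "definable_term t \<Longrightarrow> definable_term s \<Longrightarrow> definable (\<lambda>e. elts (t e) \<subseteq> elts (s e))"
  unfolding subset_eq by (rule definable_subst2[of "\<lambda>x y. \<forall>z\<in>elts x. z \<in> elts y"]) (intro dfn)

lemma isset_opairs:
  assumes "isset X" "isset Y"
  shows "isset {opair x y | x y. x \<in> X \<and> y \<in> Y}"
proof -
  obtain y where y: "elts y = Y" using assms(2) isset_def by metis
  have "isset (\<Union>x\<in>X. (\<lambda>y. opair x y) ` elts y)"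
  proof (rule isset_UN[OF _ _ assms(1)])
    have "definable_term (\<lambda>e. setof {z. \<exists>w. w \<in> elts y \<and> z = opair (e 0) w})" by (intro dfn)
    moreover have "{z. \<exists>w. w \<in> elts y \<and> z = opair x w} = (\<lambda>y. opair x y) ` elts y" for x by auto
    ultimately show "definable_term (\<lambda>e. setof ((\<lambda>y. opair (e 0) y) ` elts y))" by simp
  qed (intro isset_image dfn, simp)
  moreover have "(\<Union>x\<in>X. (\<lambda>y. opair x y) ` elts y) = {opair x y | x y. x \<in> X \<and> y \<in> Y}"
    using y by auto
  ultimately show ?thesis by simp
qed

subsection \<open>Functions\<close>

lemma fun_on_mem: "fun_on f a \<Longrightarrow> x \<in> elts a \<Longrightarrow> opair x y \<in> elts f \<longleftrightarrow> y = app f x"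
  unfolding fun_on_def app_def by (metis (mono_tags, lifting) theI')

lemma fun_on_opair: "fun_on f a \<Longrightarrow> p \<in> elts f \<longleftrightarrow> (\<exists>x\<in>elts a. p = opair x (app f x))"
  using fun_on_mem by (metis fun_on_def)

lemma fun_on_ext:
  assumes "fun_on f a" "fun_on g a" "\<And>x. x \<in> elts a \<Longrightarrow> app f x = app g x"
  shows "f = g"
  using assms by (auto intro!: elts_inject simp: fun_on_opair)

lemma func_app: "func f a b \<Longrightarrow> x \<in> elts a \<Longrightarrow> app f x \<in> elts b"
  by (simp add: func_def)

lemma func_fun_on: "func f a b \<Longrightarrow> fun_on f a"
  by (simp add: func_def)

lemma func_mono: "func f a b \<Longrightarrow> elts b \<subseteq> elts c \<Longrightarrow> func f a c"
  by (auto simp: func_def)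

lemma lam_cong: "(\<And>x. x \<in> elts a \<Longrightarrow> F x = G x) \<Longrightarrow> lam a F = lam a G"
  unfolding lam_def by (rule arg_cong[of _ _ setof]) auto

text \<open>The graph is a set by Replacement, which covers only definable \<open>F\<close>; hence
  this hypothesis accompanies every computation with \<open>lam\<close>.\<close>

lemma elts_lam:
  assumes "definable_term (\<lambda>e. F (e 0))"
  shows "elts (lam a F) = {opair x (F x) | x. x \<in> elts a}"
proof -
  have "isset ((\<lambda>x. opair x (F x)) ` elts a)" by (rule isset_image) (intro dfn assms isset_elts)+
  moreover have "(\<lambda>x. opair x (F x)) ` elts a = {opair x (F x) | x. x \<in> elts a}" by auto
  ultimately show ?thesis unfolding lam_def by (simp add: elts_setof)
qed

lemma fun_on_lam: "definable_term (\<lambda>e. F (e 0)) \<Longrightarrow> fun_on (lam a F) a"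
  by (auto simp: fun_on_def elts_lam)

lemma app_lam:
  assumes "definable_term (\<lambda>e. F (e 0))" "x \<in> elts a"
  shows "app (lam a F) x = F x"
  using fun_on_mem[OF fun_on_lam[OF assms(1)] assms(2), of "F x"] assms(2)
  by (auto simp: elts_lam[OF assms(1)])

lemma func_lam: "definable_term (\<lambda>e. F (e 0)) \<Longrightarrow> (\<And>x. x \<in> elts a \<Longrightarrow> F x \<in> elts b) \<Longrightarrow> func (lam a F) a b"
  by (simp add: func_def fun_on_lam app_lam)

text \<open>\<open>app f x\<close> is not definable in \<open>f\<close>, because \<open>THE\<close> is unspecified if there is more than
  one candidate. The variant \<open>sapp\<close> is definable and agrees with it on functions.\<close>

definition sapp :: "'v::zf \<Rightarrow> 'v \<Rightarrow> 'v" where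
  "sapp f x = (THE y. opair x y \<in> elts f \<and> (\<forall>z. opair x z \<in> elts f \<longrightarrow> z = y))"

lemma sapp_eq:
  assumes "fun_on f a" "x \<in> elts a"
  shows "sapp f x = app f x"
proof -
  have "opair x y \<in> elts f \<longleftrightarrow> y = app f x" for y using assms by (rule fun_on_mem)
  then show ?thesis unfolding sapp_def by (simp only:) (rule the_equality, blast+)
qed

lemma definable_term_sapp[dfn]: "definable_term t \<Longrightarrow> definable_term s \<Longrightarrow> definable_term (\<lambda>e. sapp (t e) (s e))"
  by (rule definable_term_subst2[of sapp], unfold sapp_def, rule definable_term_the) (intro dfn, blast)

text \<open>When \<open>f\<close> is a fixed function it enters as a parameter, and its
  single-valuedness makes the \<open>THE\<close> in \<open>app\<close> definable. A varying
  \<open>f\<close> calls for \<open>sapp\<close>.\<close>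

lemma definable_term_app:
  assumes "fun_on f a" "definable_term s"
  shows "definable_term (\<lambda>e. app f (s e))"
proof -
  have "definable_term (\<lambda>e. THE y. opair (e 0) y \<in> elts f)"
    by (rule definable_term_the) (intro dfn, insert assms(1), auto simp: fun_on_opair)
  from definable_term_subst[of "app f", OF this[folded app_def] assms(2)] show ?thesis .
qed

lemma definable_fun_on[dfn]: "definable_term t \<Longrightarrow> definable_term s \<Longrightarrow> definable (\<lambda>e. fun_on (t e) (s e))"
  by (rule definable_subst2[of fun_on], unfold fun_on_def Ex1_def) (intro dfn)

lemma func_alt: "func f a b \<longleftrightarrow> fun_on f a \<and> (\<forall>x\<in>elts a. sapp f x \<in> elts b)"
  by (auto simp: func_def sapp_eq)

lemma definable_func[dfn]:
  assumes "definable_term t" "definable_term s" "definable_term r"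
  shows "definable (\<lambda>e. func (t e) (s e) (r e))"
  unfolding func_alt by (intro dfn assms definable_term_weaken[OF assms(1)] definable_term_weaken[OF assms(3)])

lemma definable_term_funs[dfn]: "definable_term t \<Longrightarrow> definable_term s \<Longrightarrow> definable_term (\<lambda>e. funs (t e) (s e))"
  by (rule definable_term_subst2[of funs], unfold funs_def) (intro dfn)

lemma definable_term_lam[dfn]:
  assumes "definable_term a" "definable_term (\<lambda>e. F (e 0) (\<lambda>n. e (Suc n)))"
  shows "definable_term (\<lambda>e. lam (a e) (\<lambda>x. F x e))"
proof -
  have "definable_term (\<lambda>e. F (e 0) (\<lambda>n. e (Suc (Suc n))))"
    using definable_term_rename[OF assms(2), of "\<lambda>n. if n = 0 then 0 else Suc n"] by (auto simp: inj_def)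
  then show ?thesis
    unfolding lam_def by (intro dfn definable_term_weaken[OF definable_term_weaken[OF assms(1)]])
qed

lemma isset_func: "isset {f. func f a b}"
proof -
  obtain c where c: "elts c = {opair x y | x y. x \<in> elts a \<and> y \<in> elts b}"
    using isset_opairs[of "elts a" "elts b"] by (auto simp: isset_def)
  have "definable (\<lambda>e. e 0 \<in> {f. func f a b})" by (intro dfn)
  moreover have "{f. func f a b} \<subseteq> {z. elts z \<subseteq> elts c}"
    by (auto simp: c fun_on_opair[OF func_fun_on]) (erule (1) func_app)
  ultimately show ?thesis by (rule isset_subset[OF isset_Pow])
qed

lemma elts_funs: "elts (funs a b) = {f. func f a b}"
  unfolding funs_def by (rule elts_setof[OF isset_func])

lemma lam_app_id: "fun_on f a \<Longrightarrow> lam a (app f) = f"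
  by (rule fun_on_ext[of _ a]) (simp_all add: fun_on_lam app_lam definable_term_app definable_term_var)

subsection \<open>Natural numbers\<close>

lemma elts_succ[simp]: "elts (succ x) = insert x (elts x)"
  by (simp add: succ_def elts_setof)

lemma definable_term_succ[dfn]: "definable_term t \<Longrightarrow> definable_term (\<lambda>e. succ (t e))"
  by (rule definable_term_subst[of succ], unfold succ_def) (intro dfn)

lemma not_mem_self: "x \<notin> elts x"
proof -
  have "\<exists>y. y \<^bold>\<in> setof {x} \<and> \<not> (\<exists>z. z \<^bold>\<in> setof {x} \<and> z \<^bold>\<in> y)"
    by (rule foundation) (use elts_setof[of "{x}"] in \<open>auto simp: elts_def\<close>)
  then show ?thesis using elts_setof[of "{x}"] by (auto simp: elts_def)
qed

lemma not_mem_both: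
  assumes "x \<in> elts y"
  shows "y \<notin> elts x"
proof -
  have xy: "z \<^bold>\<in> setof {x, y} \<longleftrightarrow> z = x \<or> z = y" for z
    using elts_setof[of "{x, y}"] by (auto simp: elts_def)
  have "\<exists>w. w \<^bold>\<in> setof {x, y} \<and> \<not> (\<exists>z. z \<^bold>\<in> setof {x, y} \<and> z \<^bold>\<in> w)"
    by (rule foundation) (use xy in blast)
  then show ?thesis using assms unfolding xy by (auto simp: elts_def)
qed

lemma succ_inject[simp]: "succ x = succ y \<longleftrightarrow> x = y"
  using not_mem_both[of x y] elts_succ[of x] elts_succ[of y] by (metis insert_iff)

lemma succ_nonzero[simp]: "succ x \<noteq> setof {}" "setof {} \<noteq> succ x"
  using elts_succ[of x] by (metis elts_empty insert_not_empty)+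

text \<open>Infinity gives one inductive set, and the intersection of all inductive sets is
  separated from it.\<close>

lemma elts_omega:
  "elts omega = {n. \<forall>w. setof {} \<in> elts w \<and> (\<forall>k\<in>elts w. succ k \<in> elts w) \<longrightarrow> n \<in> elts w}"
proof -
  obtain u :: 'a where u: "\<exists>z. z \<^bold>\<in> u \<and> (\<forall>w. \<not> w \<^bold>\<in> z)"
    "\<And>x. x \<^bold>\<in> u \<Longrightarrow> \<exists>y. y \<^bold>\<in> u \<and> (\<forall>w. w \<^bold>\<in> y \<longleftrightarrow> w \<^bold>\<in> x \<or> w = x)"
    using infinity by blast
  have "setof {} \<in> elts u"
    using u(1) elts_inject[of _ "setof {}"] by (auto simp: elts_def[of u]) (auto simp: elts_def)
  moreover have "succ x \<in> elts u" if x: "x \<in> elts u" for x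
  proof -
    obtain y where "y \<^bold>\<in> u" "\<forall>w. w \<^bold>\<in> y \<longleftrightarrow> w \<^bold>\<in> x \<or> w = x"
      using u(2)[of x] x unfolding elts_def by blast
    then have y: "y \<in> elts u" "elts y = insert x (elts x)" by (auto simp: elts_def)
    then show ?thesis using elts_inject[of y "succ x"] by simp
  qed
  ultimately have sub: "{n. \<forall>w. setof {} \<in> elts w \<and> (\<forall>k\<in>elts w. succ k \<in> elts w) \<longrightarrow> n \<in> elts w} \<subseteq> elts u"
    by blast
  have "isset {n::'a. \<forall>w. setof {} \<in> elts w \<and> (\<forall>k\<in>elts w. succ k \<in> elts w) \<longrightarrow> n \<in> elts w}"
    by (rule isset_subset[OF isset_elts _ sub]) (intro dfn)
  then show ?thesis unfolding omega_def by (rule elts_setof)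
qed

lemma zero_omega[simp]: "setof {} \<in> elts omega"
  and succ_omega[simp]: "n \<in> elts omega \<Longrightarrow> succ n \<in> elts omega"
  by (simp_all add: elts_omega)

text \<open>The numbers satisfying \<open>P\<close> must form a set of the model in order to be an
  inductive set, so induction is available for definable \<open>P\<close> only.\<close>

lemma omega_induct[consumes 1, case_names definable zero succ]:
  assumes "n \<in> elts omega" "definable (\<lambda>e. P (e 0))" "P (setof {})"
    and "\<And>n. n \<in> elts omega \<Longrightarrow> P n \<Longrightarrow> P (succ n)"
  shows "P n"
proof -
  obtain w where w: "elts w = {n \<in> elts omega. P n}" using isset_sep[OF assms(2)] by (auto simp: isset_def)
  then have "setof {} \<in> elts w" "\<forall>k\<in>elts w. succ k \<in> elts w" using assms(3,4) by simp_all
  then have "n \<in> elts w" using assms(1) unfolding elts_omega by blast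
  then show ?thesis using w by simp
qed

lemma omega_trans: "n \<in> elts omega \<Longrightarrow> elts n \<subseteq> elts omega"
proof (induction n rule: omega_induct)
  case definable show ?case by (intro dfn)
qed auto

lemma omega_cases:
  assumes "n \<in> elts omega"
  obtains "n = setof {}" | k where "k \<in> elts omega" "n = succ k"
proof -
  have "n = setof {} \<or> (\<exists>k\<in>elts omega. n = succ k)"
    using assms
  proof (induction n rule: omega_induct)
    case definable show ?case by (intro dfn)
  qed auto
  then show ?thesis using that by blast
qed

text \<open>Choosing from finitely many nonempty sets is provable by induction: a partial tuple is
  extended by one existentially quantified value at a time. All selections of elements in the
  development reduce to this.\<close>

lemma finite_choice:
  assumes n: "n \<in> elts omega" and R: "definable (\<lambda>e. R (e 0) (e (Suc 0)))"
    and ex: "\<And>k. k \<in> elts n \<Longrightarrow> \<exists>y\<in>elts b. R k y"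
  obtains s where "func s n b" "\<And>k. k \<in> elts n \<Longrightarrow> R k (app s k)"
proof -
  \<comment> \<open>Since \<open>s\<close> is quantified here, \<open>sapp\<close> is needed for
    definability. The guard \<open>elts m \<subseteq> elts n\<close> turns a statement about
    \<open>n\<close> into one that can be proved for all of \<open>omega\<close>.\<close>
  let ?Q = "\<lambda>m. elts m \<subseteq> elts n \<longrightarrow> (\<exists>s. func s m b \<and> (\<forall>k\<in>elts m. R k (sapp s k)))"
  have "?Q m" if "m \<in> elts omega" for m
    using that
  proof (induction m rule: omega_induct)
    case definable
    have "definable (\<lambda>e. R (e i) (sapp (e j) (e k)))" for i j k
      by (rule definable_subst2[OF R]) (intro dfn)+
    then show ?case by (intro dfn)
  next
    case zero
    have "func (setof {}) (setof {}) b" by (simp add: func_def fun_on_def)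
    then show ?case by auto
  next
    case (succ m)
    show ?case
    proof
      assume *: "elts (succ m) \<subseteq> elts n"
      then obtain s where s: "func s m b" "\<forall>k\<in>elts m. R k (sapp s k)" using succ by auto
      obtain y where y: "y \<in> elts b" "R m y" using ex * by auto
      define s' where "s' = setof (insert (opair m y) (elts s))"
      have s': "elts s' = insert (opair m y) (elts s)" unfolding s'_def by (simp add: elts_setof)
      have m: "m \<notin> elts m" by (rule not_mem_self)
      have fs': "fun_on s' (succ m)"
        unfolding fun_on_def s' using m fun_on_opair[OF func_fun_on[OF s(1)]] by auto
      have a: "app s' m = y" "k \<in> elts m \<Longrightarrow> app s' k = app s k" for k
        using fun_on_mem[OF fs', of m y] fun_on_mem[OF fs', of k "app s k"]
          fun_on_mem[OF func_fun_on[OF s(1)], of k "app s k"] by (auto simp: s')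
      have "func s' (succ m) b" using fs' a y s(1) by (auto simp: func_def)
      moreover have "\<forall>k\<in>elts (succ m). R k (sapp s' k)"
        using s(2) y a sapp_eq[OF fs'] sapp_eq[OF func_fun_on[OF s(1)]] by auto
      ultimately show "\<exists>s. func s (succ m) b \<and> (\<forall>k\<in>elts (succ m). R k (sapp s k))" by blast
    qed
  qed
  from this[OF n] obtain s where s: "func s n b" "\<forall>k\<in>elts n. R k (sapp s k)" by blast
  then show ?thesis using that sapp_eq[OF func_fun_on[OF s(1)]] by simp
qed

text \<open>Finitely many monotone requirements are met one after another, since each enlargement
  preserves those already met. It serves to collect the stages or the variables of finitely many
  subterms in one set.\<close>

lemma finite_extension:
  assumes n: "n \<in> elts omega" and D: "definable (\<lambda>e. C (e 0))" "definable (\<lambda>e. Q (e 0) (e (Suc 0)))"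
    and C: "C Y"
    and step: "\<And>j Y. j \<in> elts n \<Longrightarrow> C Y \<Longrightarrow> \<exists>Z. C Z \<and> elts Y \<subseteq> elts Z \<and> Q j Z"
    and mono: "\<And>j Y Z. Q j Y \<Longrightarrow> elts Y \<subseteq> elts Z \<Longrightarrow> Q j Z"
  obtains Z where "C Z" "elts Y \<subseteq> elts Z" "\<And>j. j \<in> elts n \<Longrightarrow> Q j Z"
proof -
  let ?Q = "\<lambda>m. elts m \<subseteq> elts n \<longrightarrow> (\<exists>Z. C Z \<and> elts Y \<subseteq> elts Z \<and> (\<forall>j\<in>elts m. Q j Z))"
  have "?Q m" if "m \<in> elts omega" for m
    using that
  proof (induction m rule: omega_induct)
    case definable
    have "definable (\<lambda>e. C (e i))" "definable (\<lambda>e. Q (e i) (e j))" for i j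
      using definable_subst[OF D(1) definable_term_var] definable_subst2[OF D(2) definable_term_var definable_term_var] by auto
    then show ?case by (intro dfn)
  next
    case zero
    then show ?case using C by auto
  next
    case (succ m)
    show ?case
    proof
      assume *: "elts (succ m) \<subseteq> elts n"
      then obtain Z where Z: "C Z" "elts Y \<subseteq> elts Z" "\<forall>j\<in>elts m. Q j Z" using succ by auto
      obtain W where "C W" "elts Z \<subseteq> elts W" "Q m W" using step[OF _ Z(1), of m] * by auto
      then show "\<exists>Z. C Z \<and> elts Y \<subseteq> elts Z \<and> (\<forall>j\<in>elts (succ m). Q j Z)" using Z mono by (intro exI[of _ W]) auto
    qed
  qed
  from this[OF n] show ?thesis using that by blast
qed

lemma omega_rec:
  assumes G: "definable_term (\<lambda>e. G (e 0))"
  obtains g where "fun_on g omega" "app g (setof {}) = a"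
    "\<And>n. n \<in> elts omega \<Longrightarrow> app g (succ n) = G (app g n)"
proof -
  \<comment> \<open>An attempt only has to justify each of its pairs by a pair for the predecessor.
    Adding the next value to an attempt gives an attempt, so different attempts never have to be
    glued together.\<close>
  define att where "att g \<longleftrightarrow> (\<forall>p\<in>elts g. p = opair (setof {}) a \<or>
      (\<exists>k z. p = opair (succ k) (G z) \<and> opair k z \<in> elts g))" for g
  define Rel where "Rel n y \<longleftrightarrow> (\<exists>g. att g \<and> opair n y \<in> elts g)" for n y
  have G': "definable_term t \<Longrightarrow> definable_term (\<lambda>e. G (t e))" for t by (rule definable_term_subst[OF G])
  have DRel: "definable (\<lambda>e. Rel (e i) (e j))" for i j
    unfolding Rel_def att_def by (intro dfn G')
  have 0: "Rel (setof {}) y \<longleftrightarrow> y = a" for y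
  proof
    assume "y = a"
    moreover have "att (setof {opair (setof {}) a})" by (simp add: att_def elts_setof)
    ultimately show "Rel (setof {}) y" unfolding Rel_def
      by (intro exI[of _ "setof {opair (setof {}) a}"]) (simp add: elts_setof)
  qed (auto simp: Rel_def att_def)
  have Suc: "Rel (succ n) y \<longleftrightarrow> (\<exists>z. Rel n z \<and> y = G z)" for n y
  proof
    assume "\<exists>z. Rel n z \<and> y = G z"
    then obtain z g where g: "y = G z" "att g" "opair n z \<in> elts g" unfolding Rel_def by blast
    define g' where "g' = setof (insert (opair (succ n) y) (elts g))"
    have g': "elts g' = insert (opair (succ n) y) (elts g)" unfolding g'_def by (simp add: elts_setof)
    then have "att g'" using g unfolding att_def by auto
    then show "Rel (succ n) y" using g' unfolding Rel_def by auto
  next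
    assume "Rel (succ n) y"
    then obtain g where g: "att g" "opair (succ n) y \<in> elts g" unfolding Rel_def by blast
    then have "\<exists>z. y = G z \<and> opair n z \<in> elts g" unfolding att_def by fastforce
    then show "\<exists>z. Rel n z \<and> y = G z" using g(1) unfolding Rel_def by blast
  qed
  have ex1: "\<exists>!y. Rel n y" if "n \<in> elts omega" for n
    using that
  proof (induction n rule: omega_induct)
    case definable show ?case unfolding Ex1_def by (intro dfn DRel)
  qed (auto simp: 0 Suc)
  \<comment> \<open>The conjunct \<open>n \<in> elts omega\<close> ensures at most one witness for
    every \<open>n\<close>, as \<open>definable_term_the\<close> demands.\<close>
  define F where "F n = (THE y. n \<in> elts omega \<and> Rel n y)" for n
  have F: "F n = y \<longleftrightarrow> Rel n y" if "n \<in> elts omega" for n y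
    unfolding F_def using that theI'[OF ex1[OF that]] ex1[OF that] by auto
  have TF: "definable_term (\<lambda>e. F (e 0))"
    unfolding F_def by (rule definable_term_the) (intro dfn DRel, use ex1 in blast)
  show ?thesis
  proof (rule that[of "lam omega F"])
    show "fun_on (lam omega F) omega" by (rule fun_on_lam[OF TF])
    show "app (lam omega F) (setof {}) = a" by (simp add: app_lam[OF TF] F 0)
    fix n :: 'a assume n: "n \<in> elts omega"
    have "Rel (succ n) (G (F n))" using F[OF n, of "F n"] Suc by blast
    then show "app (lam omega F) (succ n) = G (app (lam omega F) n)"
      using n by (simp add: app_lam[OF TF] F)
  qed
qed

text \<open>The witness is the union of all post-fixed points of the operator inside \<open>Z\<close>.\<close>

lemma fixed_point:
  assumes D: "definable (\<lambda>e. \<Phi> (e 0) (e (Suc 0)))"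
    and mono: "\<And>g h p. elts g \<subseteq> elts h \<Longrightarrow> \<Phi> g p \<Longrightarrow> \<Phi> h p"
  obtains h where "\<And>p. p \<in> elts h \<longleftrightarrow> p \<in> elts Z \<and> \<Phi> h p"
proof -
  let ?P = "\<lambda>p. \<exists>g. p \<in> elts g \<and> (\<forall>q\<in>elts g. q \<in> elts Z \<and> \<Phi> g q)"
  have D': "definable (\<lambda>e. \<Phi> (e i) (e j))" for i j by (rule definable_subst2[OF D definable_term_var definable_term_var])
  have "definable (\<lambda>e. ?P (e 0))" by (intro dfn D')
  from isset_sep[OF this, of Z] obtain h where h: "elts h = {p \<in> elts Z. ?P p}"
    by (auto simp: isset_def)
  have sub: "\<Phi> h p" if p: "p \<in> elts h" for p
  proof -
    obtain g where g: "p \<in> elts g" "\<forall>q\<in>elts g. q \<in> elts Z \<and> \<Phi> g q" using p unfolding h by blast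
    then have "elts g \<subseteq> elts h" unfolding h by blast
    then show ?thesis using g mono by blast
  qed
  show ?thesis
  proof (rule that[of h])
    fix p
    show "p \<in> elts h \<longleftrightarrow> p \<in> elts Z \<and> \<Phi> h p"
    proof
      assume p: "p \<in> elts Z \<and> \<Phi> h p"
      define g where "g = setof (insert p (elts h))"
      have g: "elts g = insert p (elts h)" unfolding g_def by (simp add: elts_setof)
      have "q \<in> elts Z \<and> \<Phi> g q" if "q \<in> elts g" for q
      proof -
        have "q \<in> elts Z \<and> \<Phi> h q" using that p sub unfolding g h by auto
        then show ?thesis using mono[of h g q] g by auto
      qed
      then show "p \<in> elts h" unfolding h using p g by auto
    qed (use sub h in auto)
  qed
qed

section \<open>Terms and their evaluation\<close>

lemma definable_term_tvar[dfn]: "definable_term t \<Longrightarrow> definable_term (\<lambda>e. tvar (t e))"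
  unfolding tvar_def by (intro dfn)

lemma definable_term_tapp[dfn]: "definable_term t \<Longrightarrow> definable_term s \<Longrightarrow> definable_term (\<lambda>e. tapp (t e) (s e))"
  unfolding tapp_def by (intro dfn)

lemma tvar_inject[simp]: "tvar x = tvar y \<longleftrightarrow> x = y"
  by (simp add: tvar_def)

lemma tapp_inject[simp]: "tapp f s = tapp g t \<longleftrightarrow> f = g \<and> s = t"
  by (simp add: tapp_def)

lemma tvar_tapp[simp]: "tvar x \<noteq> tapp f s" "tapp f s \<noteq> tvar x"
  by (simp_all add: tvar_def tapp_def)

abbreviation tmap :: "'v::zf \<Rightarrow> 'v \<Rightarrow> 'v \<Rightarrow> 'v" where
  "tmap n h s \<equiv> lam n (\<lambda>k. app h (app s k))"

lemma definable_term_app_app: "func h a b \<Longrightarrow> func s n a \<Longrightarrow> definable_term (\<lambda>e. app h (app s (e 0)))"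
  by (rule definable_term_app[OF func_fun_on definable_term_app[OF func_fun_on definable_term_var]])

lemma func_tmap: "func h a b \<Longrightarrow> func s n a \<Longrightarrow> func (tmap n h s) n b"
  by (rule func_lam[OF definable_term_app_app]) (auto intro: func_app)

lemma app_tmap: "func h a b \<Longrightarrow> func s n a \<Longrightarrow> k \<in> elts n \<Longrightarrow> app (tmap n h s) k = app h (app s k)"
  by (rule app_lam[OF definable_term_app_app])

lemma tmap_tmap:
  assumes "func g b c" "func h a b" "func s n a"
  shows "tmap n g (tmap n h s) = tmap n (tmap a g h) s"
  using assms by (intro lam_cong) (simp add: app_tmap[OF assms(2,3)] app_tmap[OF assms(1,2)] func_app)

text \<open>The tuple is finite, so \<open>finite_choice\<close> selects preimages of its entries,
  although without choice \<open>h\<close> may have no right inverse.\<close>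

lemma lift_tuple:
  assumes "n \<in> elts omega" "func h a b" "func s n b"
    and "\<And>k. k \<in> elts n \<Longrightarrow> \<exists>x\<in>elts a. app h x = app s k"
  obtains s' where "func s' n a" "s = tmap n h s'"
proof -
  have "definable (\<lambda>e. app h (e (Suc 0)) = app s (e 0))"
    by (intro dfn definable_term_app[OF func_fun_on[OF assms(2)]] definable_term_app[OF func_fun_on[OF assms(3)]])
  from finite_choice[of n "\<lambda>k x. app h x = app s k", OF assms(1) this assms(4)] obtain s' where
    s': "func s' n a" "\<And>k. k \<in> elts n \<Longrightarrow> app h (app s' k) = app s k"
    by blast
  have "s = tmap n h s'"
    by (rule fun_on_ext[OF func_fun_on[OF assms(3)] func_fun_on[OF func_tmap[OF assms(2) s'(1)]]])
      (simp add: app_tmap[OF assms(2) s'(1)] s'(2))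
  then show ?thesis using that s'(1) by blast
qed

locale signat =
  fixes \<Sigma> :: "'v::zf signature"
  assumes sig: "is_signature \<Sigma>"
begin

abbreviation "Sym \<equiv> setof (elts (rels \<Sigma>) \<union> elts (funcs \<Sigma>))"

lemma elts_Sym: "elts Sym = elts (rels \<Sigma>) \<union> elts (funcs \<Sigma>)"
  by (simp add: elts_setof)

lemma rel_not_func: "r \<in> elts (rels \<Sigma>) \<Longrightarrow> r \<notin> elts (funcs \<Sigma>)"
  using sig by (auto simp: is_signature_def)

lemma ar_omega: "c \<in> elts (rels \<Sigma>) \<or> c \<in> elts (funcs \<Sigma>) \<Longrightarrow> ar \<Sigma> c \<in> elts omega"
  using sig func_app[of "arity \<Sigma>" Sym omega c] by (auto simp: is_signature_def elts_Sym)

lemma ar_func: "f \<in> elts (funcs \<Sigma>) \<Longrightarrow> ar \<Sigma> f \<in> elts omega"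
  and ar_rel: "r \<in> elts (rels \<Sigma>) \<Longrightarrow> ar \<Sigma> r \<in> elts omega"
  using ar_omega by blast+

lemma definable_term_ar[dfn]: "definable_term t \<Longrightarrow> definable_term (\<lambda>e. ar \<Sigma> (t e))"
  using sig by (auto simp: is_signature_def intro: definable_term_app[OF func_fun_on])

lemma definable_term_closed[dfn]: "definable_term t \<Longrightarrow> definable (\<lambda>e. term_closed \<Sigma> X (t e))"
  by (rule definable_subst[of "\<lambda>T e. term_closed \<Sigma> X T"], unfold term_closed_def) (intro dfn)

text \<open>A bound that turns the intersection in \<open>terms\<close> into a set: iterate the
  one-step operator \<open>S\<close> along \<open>omega\<close>, starting from the empty set.
  Arities are finite, so a tuple over the union lies in a single stage, and applying a symbol to it
  leads into the next stage.\<close>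

lemma ex_term_closed: "\<exists>T. term_closed \<Sigma> X T"
proof -
  define S where "S y = {t. (\<exists>x\<in>elts X. t = tvar x) \<or>
     (\<exists>f\<in>elts (funcs \<Sigma>). \<exists>s\<in>elts (funs (ar \<Sigma> f) y). t = tapp f s)}" for y
  have "definable_term (\<lambda>e. setof (tapp (e 0) ` elts (funs (ar \<Sigma> (e 0)) y)))" for y
  proof -
    have "definable_term (\<lambda>e. setof {t. \<exists>s\<in>elts (funs (ar \<Sigma> (e 0)) y). t = tapp (e 0) s})" by (intro dfn)
    then show ?thesis by (simp add: image_def)
  qed
  then have "isset (\<Union>f\<in>elts (funcs \<Sigma>). tapp f ` elts (funs (ar \<Sigma> f) y))" for y
    by (rule isset_UN) (intro isset_image dfn isset_elts)+
  moreover have "isset (tvar ` elts X)" by (intro isset_image dfn isset_elts)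
  moreover have "S y = tvar ` elts X \<union> (\<Union>f\<in>elts (funcs \<Sigma>). tapp f ` elts (funs (ar \<Sigma> f) y))" for y
    by (auto simp: S_def)
  ultimately have elts_S: "elts (setof (S y)) = S y" for y by (intro elts_setof) simp
  have TS: "definable_term (\<lambda>e. setof (S (e 0)))" unfolding S_def by (intro dfn)
  obtain g where g: "fun_on g omega" "app g (setof {}) = setof {}"
    "\<And>n. n \<in> elts omega \<Longrightarrow> app g (succ n) = setof (S (app g n))"
    using omega_rec[OF TS] by blast
  have S_mono: "S y \<subseteq> S z" if "elts y \<subseteq> elts z" for y z
    using that by (fastforce simp: S_def elts_funs intro: func_mono)
  \<comment> \<open>Two stages are comparable because their predecessors are, by
    \<open>S_mono\<close>; this takes the place of an order on \<open>omega\<close>.\<close>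
  have chain: "\<forall>m\<in>elts (omega::'v). elts (app g n) \<subseteq> elts (app g m) \<or> elts (app g m) \<subseteq> elts (app g n)"
    if "n \<in> elts omega" for n
    using that
  proof (induction n rule: omega_induct)
    case definable show ?case by (intro dfn definable_term_app[OF g(1)])
  next
    case (succ n)
    show ?case
    proof
      fix m :: 'v assume "m \<in> elts omega"
      then show "elts (app g (succ n)) \<subseteq> elts (app g m) \<or> elts (app g m) \<subseteq> elts (app g (succ n))"
      proof (cases rule: omega_cases)
        case (2 k)
        then show ?thesis using succ S_mono by (auto simp: g elts_S dest!: bspec)
      qed (simp add: g)
    qed
  qed (simp add: g)
  define U where "U = setof (\<Union>n\<in>elts omega. elts (app g n))"
  have U: "elts U = (\<Union>n\<in>elts omega. elts (app g n))"
    unfolding U_def by (rule elts_setof[OF isset_UN]) (simp_all, intro definable_term_app[OF g(1)] dfn)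
  have "S U \<subseteq> elts U"
  proof
    fix t assume "t \<in> S U"
    moreover have "tvar x \<in> elts U" if "x \<in> elts X" for x
    proof -
      have "tvar x \<in> elts (app g (succ (setof {})))"
        unfolding g(3)[OF zero_omega] elts_S using that by (simp add: S_def)
      then show ?thesis unfolding U using succ_omega[OF zero_omega] by blast
    qed
    moreover have "tapp f s \<in> elts U" if f: "f \<in> elts (funcs \<Sigma>)" and s: "func s (ar \<Sigma> f) U" for f s
    proof -
      let ?C = "\<lambda>Y. \<exists>n\<in>elts omega. Y = app g n"
      obtain Y where "?C Y" and Y: "\<And>k. k \<in> elts (ar \<Sigma> f) \<Longrightarrow> app s k \<in> elts Y"
      proof (rule finite_extension[of "ar \<Sigma> f" ?C "\<lambda>k Y. app s k \<in> elts Y" "app g (setof {})"])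
        show "ar \<Sigma> f \<in> elts omega" using f by (rule ar_func)
        show "definable (\<lambda>e. ?C (e 0))" "definable (\<lambda>e. app s (e 0) \<in> elts (e (Suc 0)))"
          by (intro dfn definable_term_app[OF g(1)] definable_term_app[OF func_fun_on[OF s]])+
        show "?C (app g (setof {}))" using zero_omega by blast
      next
        fix k Y assume k: "k \<in> elts (ar \<Sigma> f)" and "?C Y"
        then obtain n where n: "n \<in> elts omega" "Y = app g n" by blast
        obtain m where m: "m \<in> elts omega" "app s k \<in> elts (app g m)"
          using func_app[OF s k] U by blast
        show "\<exists>Z. ?C Z \<and> elts Y \<subseteq> elts Z \<and> app s k \<in> elts Z"
          using chain[OF n(1)] n m by blast
      qed auto
      then obtain n where n: "n \<in> elts omega" "Y = app g n" by blast
      have "func s (ar \<Sigma> f) (app g n)" using s Y n by (simp add: func_def)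
      then have "tapp f s \<in> elts (app g (succ n))"
        unfolding g(3)[OF n(1)] elts_S using f by (auto simp: S_def elts_funs)
      then show ?thesis using succ_omega[OF n(1)] unfolding U by blast
    qed
    ultimately show "t \<in> elts U" by (auto simp: S_def elts_funs)
  qed
  then have "term_closed \<Sigma> X U" by (auto simp: term_closed_def S_def)
  then show ?thesis by blast
qed

lemma elts_terms: "elts (terms \<Sigma> X) = {t. \<forall>T. term_closed \<Sigma> X T \<longrightarrow> t \<in> elts T}"
proof -
  obtain U where "term_closed \<Sigma> X U" using ex_term_closed by blast
  then have sub: "{t. \<forall>T. term_closed \<Sigma> X T \<longrightarrow> t \<in> elts T} \<subseteq> elts U" by blast
  show ?thesis
    unfolding terms_def by (rule elts_setof[OF isset_subset[OF isset_elts _ sub]]) (intro dfn)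
qed

lemma definable_term_terms[dfn]: "definable_term t \<Longrightarrow> definable_term (\<lambda>e. terms \<Sigma> (t e))"
  by (rule definable_term_subst[of "terms \<Sigma>"], unfold terms_def term_closed_def) (intro dfn)

lemma tvar_terms: "x \<in> elts X \<Longrightarrow> tvar x \<in> elts (terms \<Sigma> X)"
  by (simp add: elts_terms term_closed_def)

lemma tapp_terms:
  assumes "f \<in> elts (funcs \<Sigma>)" "func s (ar \<Sigma> f) (terms \<Sigma> X)"
  shows "tapp f s \<in> elts (terms \<Sigma> X)"
proof -
  have "tapp f s \<in> elts T" if "term_closed \<Sigma> X T" for T
  proof -
    have "elts (terms \<Sigma> X) \<subseteq> elts T" using that by (auto simp: elts_terms)
    then have "func s (ar \<Sigma> f) T" using assms(2) by (rule func_mono[rotated])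
    then show ?thesis using that assms(1) by (auto simp: term_closed_def elts_funs)
  qed
  then show ?thesis by (simp add: elts_terms)
qed

lemma terms_induct[consumes 1, case_names definable tvar tapp]:
  assumes "t \<in> elts (terms \<Sigma> X)" "definable (\<lambda>e. P (e 0))"
    and "\<And>x. x \<in> elts X \<Longrightarrow> P (tvar x)"
    and "\<And>f s. f \<in> elts (funcs \<Sigma>) \<Longrightarrow> func s (ar \<Sigma> f) (terms \<Sigma> X) \<Longrightarrow>
      (\<And>k. k \<in> elts (ar \<Sigma> f) \<Longrightarrow> P (app s k)) \<Longrightarrow> P (tapp f s)"
  shows "P t"
proof -
  obtain W where W: "elts W = {t \<in> elts (terms \<Sigma> X). P t}"
    using isset_sep[OF assms(2)] by (auto simp: isset_def)
  have "term_closed \<Sigma> X W"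
    unfolding term_closed_def elts_funs
  proof (intro conjI ballI)
    fix f s assume f: "f \<in> elts (funcs \<Sigma>)" and "s \<in> {s. func s (ar \<Sigma> f) W}"
    then have s: "func s (ar \<Sigma> f) W" by simp
    then have "func s (ar \<Sigma> f) (terms \<Sigma> X)" by (rule func_mono) (auto simp: W)
    then show "tapp f s \<in> elts W" using f tapp_terms assms(4) func_app[OF s] by (auto simp: W)
  qed (simp add: W assms(3) tvar_terms)
  then have "t \<in> elts W" using assms(1) by (simp add: elts_terms)
  then show ?thesis by (simp add: W)
qed

lemma terms_mono:
  assumes "elts Y \<subseteq> elts X"
  shows "elts (terms \<Sigma> Y) \<subseteq> elts (terms \<Sigma> X)"
proof
  fix t assume "t \<in> elts (terms \<Sigma> Y)"
  then show "t \<in> elts (terms \<Sigma> X)"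
  proof (induction t rule: terms_induct)
    case definable show ?case by (intro dfn)
  next
    case (tapp f s)
    then show ?case by (intro tapp_terms) (auto simp: func_def)
  qed (use assms in \<open>auto intro: tvar_terms\<close>)
qed

end

section \<open>Structures\<close>

lemma univ_opair[simp]: "univ (opair a i) = a"
  by (simp add: univ_def)

lemma interp_opair[simp]: "interp (opair a i) c = app i c"
  by (simp add: interp_def)

lemma definable_term_univ[dfn]: "definable_term t \<Longrightarrow> definable_term (\<lambda>e. univ (t e))"
  by (rule definable_term_subst[of univ], unfold univ_def, rule definable_term_the) (intro dfn, auto)

text \<open>\<open>interp\<close> goes through \<open>app\<close> and is therefore definable only
  for a fixed structure. This variant lets the structure vary as well, as in the factors of a
  product.\<close>

definition sinterp :: "'v::zf \<Rightarrow> 'v \<Rightarrow> 'v" where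
  "sinterp M c = sapp (THE i. \<exists>a. M = opair a i) c"

lemma definable_term_sinterp[dfn]: "definable_term t \<Longrightarrow> definable_term s \<Longrightarrow> definable_term (\<lambda>e. sinterp (t e) (s e))"
proof (rule definable_term_subst2[of sinterp])
  have "definable_term (\<lambda>e. THE i. \<exists>a. e j = opair a i)" for j
    by (rule definable_term_the) (intro dfn, auto)
  then show "definable_term (\<lambda>e. sinterp (e 0) (e (Suc 0)))" unfolding sinterp_def by (intro dfn)
qed

context signat
begin

lemma struct_fun: "is_struct \<Sigma> A \<Longrightarrow> f \<in> elts (funcs \<Sigma>) \<Longrightarrow> func (interp A f) (funs (ar \<Sigma> f) (univ A)) (univ A)"
  by (simp add: is_struct_def)

lemma struct_fun_app:
  "is_struct \<Sigma> A \<Longrightarrow> f \<in> elts (funcs \<Sigma>) \<Longrightarrow> func s (ar \<Sigma> f) (univ A) \<Longrightarrow> app (interp A f) s \<in> elts (univ A)"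
  using func_app[OF struct_fun] by (simp add: elts_funs)

lemma struct_rel: "is_struct \<Sigma> A \<Longrightarrow> r \<in> elts (rels \<Sigma>) \<Longrightarrow> s \<in> elts (interp A r) \<Longrightarrow> func s (ar \<Sigma> r) (univ A)"
  by (auto simp: is_struct_def elts_funs)

lemma struct_nonempty: "is_struct \<Sigma> A \<Longrightarrow> \<exists>x. x \<in> elts (univ A)"
  by (auto simp: is_struct_def)

lemma definable_term_interp:
  assumes "is_struct \<Sigma> A" "definable_term t"
  shows "definable_term (\<lambda>e. interp A (t e))"
proof -
  obtain a i where "A = opair a i" "fun_on i Sym" using assms(1) by (auto simp: is_struct_def)
  then show ?thesis using definable_term_app[OF _ assms(2)] by simp
qed

lemma sinterp_eq: "is_struct \<Sigma> A \<Longrightarrow> c \<in> elts (rels \<Sigma>) \<or> c \<in> elts (funcs \<Sigma>) \<Longrightarrow> sinterp A c = interp A c"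
  unfolding is_struct_def sinterp_def interp_def by (auto simp: elts_Sym sapp_eq)

lemma sinterp_sapp:
  "is_struct \<Sigma> A \<Longrightarrow> f \<in> elts (funcs \<Sigma>) \<Longrightarrow> func s (ar \<Sigma> f) (univ A) \<Longrightarrow>
    sapp (sinterp A f) s = app (interp A f) s"
  using sapp_eq[OF func_fun_on[OF struct_fun]] by (simp add: sinterp_eq elts_funs)

text \<open>The constructions of structures below all rest on this lemma: definable operations and
  relations are assembled into one interpretation function by Replacement and Separation.\<close>

lemma mk_struct:
  assumes F: "definable_term (\<lambda>e. F (e 0) (e (Suc 0)))" and R: "definable (\<lambda>e. R (e 0) (e (Suc 0)))"
    and ne: "x \<in> elts a"
    and cl: "\<And>f s. f \<in> elts (funcs \<Sigma>) \<Longrightarrow> func s (ar \<Sigma> f) a \<Longrightarrow> F f s \<in> elts a"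
  obtains B where "is_struct \<Sigma> B" "univ B = a"
    "\<And>f s. f \<in> elts (funcs \<Sigma>) \<Longrightarrow> func s (ar \<Sigma> f) a \<Longrightarrow> app (interp B f) s = F f s"
    "\<And>r s. r \<in> elts (rels \<Sigma>) \<Longrightarrow> s \<in> elts (interp B r) \<longleftrightarrow> func s (ar \<Sigma> r) a \<and> R r s"
proof -
  note TF = definable_term_subst2[OF F] and DR = definable_subst2[OF R]
  \<comment> \<open>One function interprets both kinds of symbols. Because \<open>rels\<close> and
    \<open>funcs\<close> are disjoint, a relation symbol always reaches the second branch.\<close>
  let ?I = "\<lambda>c. if c \<in> elts (funcs \<Sigma>) then lam (funs (ar \<Sigma> c) a) (F c)
    else setof {s. s \<in> elts (funs (ar \<Sigma> c) a) \<and> R c s}"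
  have TI: "definable_term (\<lambda>e. ?I (e 0))" by (intro definable_term_if dfn TF DR)
  let ?B = "opair a (lam Sym ?I)"
  have I: "app (lam Sym ?I) c = ?I c" if "c \<in> elts (rels \<Sigma>) \<or> c \<in> elts (funcs \<Sigma>)" for c
    using app_lam[OF TI, of c Sym] that by (simp add: elts_Sym)
  have TFc: "definable_term (\<lambda>e. F f (e 0))" for f by (intro TF dfn)
  have f: "interp ?B f = lam (funs (ar \<Sigma> f) a) (F f)" if "f \<in> elts (funcs \<Sigma>)" for f
    using I[of f] that by simp
  have "definable (\<lambda>e. R r (e 0))" for r by (intro DR dfn)
  then have "isset {s \<in> elts (funs (ar \<Sigma> r) a). R r s}" for r by (rule isset_sep)
  then have r: "elts (interp ?B r) = {s. func s (ar \<Sigma> r) a \<and> R r s}" if "r \<in> elts (rels \<Sigma>)" for r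
    using I[of r] that rel_not_func[OF that] by (simp add: elts_setof elts_funs)
  show ?thesis
  proof (rule that[of ?B])
    show "is_struct \<Sigma> ?B"
      unfolding is_struct_def
    proof (intro conjI ballI)
      show "\<exists>b i. ?B = opair b i \<and> fun_on i Sym" using fun_on_lam[OF TI] by blast
      show "elts (univ ?B) \<noteq> {}" using ne by auto
    next
      fix f assume "f \<in> elts (funcs \<Sigma>)"
      then show "func (interp ?B f) (funs (ar \<Sigma> f) (univ ?B)) (univ ?B)"
        unfolding f[OF \<open>f \<in> elts (funcs \<Sigma>)\<close>] univ_opair by (intro func_lam TFc cl) (simp_all add: elts_funs)
    next
      fix s assume "s \<in> elts (rels \<Sigma>)"
      then show "elts (interp ?B s) \<subseteq> elts (funs (ar \<Sigma> s) (univ ?B))"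
        by (auto simp: r elts_funs simp del: interp_opair)
    qed
    show "univ ?B = a" by simp
    show "app (interp ?B g) s = F g s" if "g \<in> elts (funcs \<Sigma>)" "func s (ar \<Sigma> g) a" for g s
      using that app_lam[OF TFc, of s "funs (ar \<Sigma> g) a" g] by (simp add: f elts_funs del: interp_opair)
    show "s \<in> elts (interp ?B q) \<longleftrightarrow> func s (ar \<Sigma> q) a \<and> R q s" if "q \<in> elts (rels \<Sigma>)" for q s
      using that by (simp add: r del: interp_opair)
  qed
qed

section \<open>Evaluation of terms in a structure\<close>

definition evf :: "'v \<Rightarrow> 'v \<Rightarrow> 'v \<Rightarrow> 'v" where
  "evf X A v = (THE h. is_eval \<Sigma> X A v h)"

lemma eval_evf: "eval \<Sigma> X A v t = app (evf X A v) t"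
  by (simp add: eval_def evf_def)

text \<open>Recursion on terms comes from a fixed point of \<open>\<Phi>\<close>, which accepts a
  pair of a term and a value if it is justified by the assignment or by accepted pairs for all
  arguments. Induction on terms shows that such a fixed point gives every term exactly one
  value.\<close>

lemma ex_eval:
  assumes A: "is_struct \<Sigma> A" and v: "func v X (univ A)"
  shows "\<exists>h. is_eval \<Sigma> X A v h"
proof -
  let ?T = "terms \<Sigma> X"
  define \<Phi> where "\<Phi> g p \<longleftrightarrow> (\<exists>x\<in>elts X. p = opair (tvar x) (app v x)) \<or>
    (\<exists>f\<in>elts (funcs \<Sigma>). \<exists>s\<in>elts (funs (ar \<Sigma> f) ?T). \<exists>a\<in>elts (funs (ar \<Sigma> f) (univ A)).
      p = opair (tapp f s) (sapp (interp A f) a) \<and>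
      (\<forall>k\<in>elts (ar \<Sigma> f). opair (sapp s k) (sapp a k) \<in> elts g))" for g p
  have "isset {opair t y | t y. t \<in> elts ?T \<and> y \<in> elts (univ A)}" by (rule isset_opairs) simp_all
  then obtain Z where Z: "elts Z = {opair t y | t y. t \<in> elts ?T \<and> y \<in> elts (univ A)}"
    by (auto simp: isset_def)
  obtain h where h: "\<And>p. p \<in> elts h \<longleftrightarrow> p \<in> elts Z \<and> \<Phi> h p"
  proof (rule fixed_point[of \<Phi> Z])
    show "definable (\<lambda>e. \<Phi> (e 0) (e (Suc 0)))"
      unfolding \<Phi>_def by (intro dfn definable_term_app[OF func_fun_on[OF v]] definable_term_interp[OF A])
    show "\<Phi> g' p" if "elts g \<subseteq> elts g'" "\<Phi> g p" for g g' p
      using that unfolding \<Phi>_def by blast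
  qed blast
  have h_sub: "t \<in> elts ?T \<and> y \<in> elts (univ A)" if "opair t y \<in> elts h" for t y
    using that unfolding h[of "opair t y"] Z by simp
  have h_var: "opair (tvar x) y \<in> elts h \<longleftrightarrow> y = app v x" if "x \<in> elts X" for x y
    unfolding h[of "opair (tvar x) y"] Z \<Phi>_def using that tvar_terms func_app[OF v] by auto
  have h_app: "opair (tapp f s) y \<in> elts h \<longleftrightarrow> (\<exists>a. func a (ar \<Sigma> f) (univ A) \<and>
      y = app (interp A f) a \<and> (\<forall>k\<in>elts (ar \<Sigma> f). opair (app s k) (app a k) \<in> elts h))"
    if f: "f \<in> elts (funcs \<Sigma>)" and s: "func s (ar \<Sigma> f) ?T" for f s y
  proof -
    have "\<Phi> h (opair (tapp f s) y) \<longleftrightarrow> (\<exists>a. func a (ar \<Sigma> f) (univ A) \<and>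
      y = app (interp A f) a \<and> (\<forall>k\<in>elts (ar \<Sigma> f). opair (app s k) (app a k) \<in> elts h))"
      unfolding \<Phi>_def using f s
      by (auto simp: elts_funs sapp_eq[OF func_fun_on[OF s]] sapp_eq[OF func_fun_on]
          sapp_eq[OF func_fun_on[OF struct_fun[OF A f]]])
    then show ?thesis unfolding h[of "opair (tapp f s) y"] Z
      using tapp_terms[OF f s] struct_fun_app[OF A f] by auto
  qed
  have ex1: "\<exists>!y. opair t y \<in> elts h" if "t \<in> elts ?T" for t
    using that
  proof (induction t rule: terms_induct)
    case definable show ?case unfolding Ex1_def by (intro dfn)
  next
    case (tapp f s)
    have ex: "\<exists>y\<in>elts (univ A). opair (app s k) y \<in> elts h" if "k \<in> elts (ar \<Sigma> f)" for k
      using tapp(3)[OF that] h_sub by blast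
    have D: "definable (\<lambda>e. opair (app s (e 0)) (e (Suc 0)) \<in> elts h)"
      by (intro dfn definable_term_app[OF func_fun_on[OF tapp(2)]])
    obtain a where a: "func a (ar \<Sigma> f) (univ A)"
      "\<And>k. k \<in> elts (ar \<Sigma> f) \<Longrightarrow> opair (app s k) (app a k) \<in> elts h"
      using finite_choice[OF ar_func[OF tapp(1)], of "\<lambda>k y. opair (app s k) y \<in> elts h", OF D ex] by blast
    have "b = a" if "func b (ar \<Sigma> f) (univ A)" "\<forall>k\<in>elts (ar \<Sigma> f). opair (app s k) (app b k) \<in> elts h" for b
      using tapp(3) a(2) that by (intro fun_on_ext[OF func_fun_on[OF that(1)] func_fun_on[OF a(1)]]) blast
    then show ?case unfolding h_app[OF tapp(1,2)] using a by blast
  qed (use h_var in auto)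
  have fh: "fun_on h ?T"
    unfolding fun_on_def using ex1 h[THEN iffD1] unfolding Z by blast
  have happ: "opair t y \<in> elts h \<longleftrightarrow> y = app h t" if "t \<in> elts ?T" for t y
    using fun_on_mem[OF fh that] .
  have func_h: "func h ?T (univ A)"
    using fh happ h_sub unfolding func_def by blast
  have "app h (tapp f s) = app (interp A f) (tmap (ar \<Sigma> f) h s)"
    if f: "f \<in> elts (funcs \<Sigma>)" and s: "func s (ar \<Sigma> f) ?T" for f s
  proof -
    have "opair (tapp f s) (app (interp A f) (tmap (ar \<Sigma> f) h s)) \<in> elts h"
      unfolding h_app[OF f s] using func_tmap[OF func_h s] happ func_app[OF s]
      by (intro exI[of _ "tmap (ar \<Sigma> f) h s"]) (simp add: app_tmap[OF func_h s])
    then show ?thesis using happ[OF tapp_terms[OF f s]] by simp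
  qed
  moreover have "app h (tvar x) = app v x" if "x \<in> elts X" for x
    using h_var[OF that] happ[OF tvar_terms[OF that]] by blast
  ultimately have "is_eval \<Sigma> X A v h" using func_h by (auto simp: is_eval_def elts_funs)
  then show ?thesis by blast
qed

text \<open>One induction serves two purposes: equal assignments and \<open>Y = X\<close> give
  uniqueness of the evaluation map, and a smaller \<open>Y\<close> gives the dependence of a value
  on the occurring variables alone. The lemma speaks of \<open>is_eval\<close> because
  \<open>evf\<close> has no properties before uniqueness is known.\<close>

lemma eval_agree:
  assumes h: "is_eval \<Sigma> X A v h" and h': "is_eval \<Sigma> X A w h'"
    and Y: "elts Y \<subseteq> elts X" and vw: "\<And>x. x \<in> elts Y \<Longrightarrow> app v x = app w x"
    and t: "t \<in> elts (terms \<Sigma> Y)"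
  shows "app h t = app h' t"
proof -
  have f: "func h (terms \<Sigma> X) (univ A)" "func h' (terms \<Sigma> X) (univ A)"
    using h h' by (simp_all add: is_eval_def)
  show ?thesis using t
  proof (induction t rule: terms_induct)
    case definable show ?case by (intro dfn definable_term_app[OF func_fun_on[OF f(1)]] definable_term_app[OF func_fun_on[OF f(2)]])
  next
    case (tvar x)
    then show ?case using h h' Y vw by (auto simp: is_eval_def)
  next
    case (tapp g s)
    have "func s (ar \<Sigma> g) (terms \<Sigma> X)" using func_mono[OF tapp(2) terms_mono[OF Y]] .
    moreover have "tmap (ar \<Sigma> g) h s = tmap (ar \<Sigma> g) h' s" using tapp(3) by (rule lam_cong)
    ultimately show ?case using h h' tapp(1) by (simp add: is_eval_def elts_funs)
  qed
qed

lemma eval_unique: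
  assumes "is_eval \<Sigma> X A v h" "is_eval \<Sigma> X A v h'"
  shows "h = h'"
proof (rule fun_on_ext)
  show "fun_on h (terms \<Sigma> X)" "fun_on h' (terms \<Sigma> X)"
    using assms by (simp_all add: is_eval_def func_def)
  show "app h t = app h' t" if "t \<in> elts (terms \<Sigma> X)" for t
    using eval_agree[OF assms _ _ that] by simp
qed

lemma is_eval_evf: "is_struct \<Sigma> A \<Longrightarrow> func v X (univ A) \<Longrightarrow> is_eval \<Sigma> X A v (evf X A v)"
  unfolding evf_def using theI'[of "is_eval \<Sigma> X A v"] ex_eval eval_unique by blast

lemma
  assumes "is_struct \<Sigma> A" "func v X (univ A)"
  shows func_evf: "func (evf X A v) (terms \<Sigma> X) (univ A)"
    and evf_tvar: "x \<in> elts X \<Longrightarrow> app (evf X A v) (tvar x) = app v x"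
    and evf_tapp: "f \<in> elts (funcs \<Sigma>) \<Longrightarrow> func s (ar \<Sigma> f) (terms \<Sigma> X) \<Longrightarrow>
      app (evf X A v) (tapp f s) = app (interp A f) (tmap (ar \<Sigma> f) (evf X A v) s)"
  using is_eval_evf[OF assms] by (simp_all add: is_eval_def elts_funs)

lemma evf_agree:
  assumes "is_struct \<Sigma> A" "func v X (univ A)" "func w X (univ A)" "elts Y \<subseteq> elts X"
    and "\<And>x. x \<in> elts Y \<Longrightarrow> app v x = app w x" "t \<in> elts (terms \<Sigma> Y)"
  shows "app (evf X A v) t = app (evf X A w) t"
  using eval_agree[OF is_eval_evf is_eval_evf] assms by blast

end

section \<open>Homomorphisms and constructions of structures\<close>

context signat
begin

lemma is_homI:
  assumes "func h (univ A) (univ B)"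
    and "\<And>f s. f \<in> elts (funcs \<Sigma>) \<Longrightarrow> func s (ar \<Sigma> f) (univ A) \<Longrightarrow>
      app h (app (interp A f) s) = app (interp B f) (tmap (ar \<Sigma> f) h s)"
    and "\<And>r s. r \<in> elts (rels \<Sigma>) \<Longrightarrow> s \<in> elts (interp A r) \<Longrightarrow> tmap (ar \<Sigma> r) h s \<in> elts (interp B r)"
  shows "is_hom \<Sigma> h A B"
  using assms by (simp add: is_hom_def elts_funs)

lemma
  assumes "is_hom \<Sigma> h A B"
  shows hom_func: "func h (univ A) (univ B)"
    and hom_fun: "f \<in> elts (funcs \<Sigma>) \<Longrightarrow> func s (ar \<Sigma> f) (univ A) \<Longrightarrow>
      app h (app (interp A f) s) = app (interp B f) (tmap (ar \<Sigma> f) h s)"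
    and hom_rel: "r \<in> elts (rels \<Sigma>) \<Longrightarrow> s \<in> elts (interp A r) \<Longrightarrow> tmap (ar \<Sigma> r) h s \<in> elts (interp B r)"
  using assms by (simp_all add: is_hom_def elts_funs)

lemma hom_comp:
  assumes A: "is_struct \<Sigma> A" and h: "is_hom \<Sigma> h A B" and g: "is_hom \<Sigma> g B C"
  shows "is_hom \<Sigma> (tmap (univ A) g h) A C"
proof (rule is_homI)
  note fh = hom_func[OF h] and fg = hom_func[OF g]
  show "func (tmap (univ A) g h) (univ A) (univ C)" by (rule func_tmap[OF fg fh])
  show "app (tmap (univ A) g h) (app (interp A f) s) =
      app (interp C f) (tmap (ar \<Sigma> f) (tmap (univ A) g h) s)"
    if f: "f \<in> elts (funcs \<Sigma>)" and s: "func s (ar \<Sigma> f) (univ A)" for f s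
    using hom_fun[OF h f s] hom_fun[OF g f func_tmap[OF fh s]] tmap_tmap[OF fg fh s]
    by (simp add: app_tmap[OF fg fh struct_fun_app[OF A f s]])
  show "tmap (ar \<Sigma> r) (tmap (univ A) g h) s \<in> elts (interp C r)"
    if r: "r \<in> elts (rels \<Sigma>)" and s: "s \<in> elts (interp A r)" for r s
    using hom_rel[OF g r hom_rel[OF h r s]] tmap_tmap[OF fg fh struct_rel[OF A r s]] by simp
qed

lemma hom_evf:
  assumes A: "is_struct \<Sigma> A" and B: "is_struct \<Sigma> B" and h: "is_hom \<Sigma> h A B"
    and v: "func v X (univ A)" and t: "t \<in> elts (terms \<Sigma> X)"
  shows "app h (app (evf X A v) t) = app (evf X B (tmap X h v)) t"
proof -
  note fh = hom_func[OF h]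
  note hv = func_tmap[OF fh v]
  note eA = func_evf[OF A v] and eB = func_evf[OF B hv]
  show ?thesis using t
  proof (induction t rule: terms_induct)
    case definable show ?case
      by (intro dfn definable_term_app[OF func_fun_on[OF fh]] definable_term_app[OF func_fun_on[OF eA]] definable_term_app[OF func_fun_on[OF eB]])
  next
    case (tvar x)
    then show ?case by (simp add: evf_tvar[OF A v] evf_tvar[OF B hv] app_tmap[OF fh v])
  next
    case (tapp f s)
    have "tmap (ar \<Sigma> f) h (tmap (ar \<Sigma> f) (evf X A v) s) = tmap (ar \<Sigma> f) (evf X B (tmap X h v)) s"
      by (rule lam_cong) (simp add: app_tmap[OF eA tapp(2)] tapp(3))
    then show ?case
      using hom_fun[OF h tapp(1) func_tmap[OF eA tapp(2)]]
      by (simp add: evf_tapp[OF A v tapp(1,2)] evf_tapp[OF B hv tapp(1,2)])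
  qed
qed

lemma hom_tmap_evf:
  assumes "is_struct \<Sigma> A" "is_struct \<Sigma> B" "is_hom \<Sigma> h A B" "func v X (univ A)" "func s n (terms \<Sigma> X)"
  shows "tmap n h (tmap n (evf X A v) s) = tmap n (evf X B (tmap X h v)) s"
  by (rule lam_cong)
    (simp add: app_tmap[OF func_evf[OF assms(1,4)] assms(5)] hom_evf[OF assms(1-4)] func_app[OF assms(5)])

text \<open>Renaming variables is evaluation in the structure of terms, and evaluating in
  \<open>A\<close> is a homomorphism out of that structure, so \<open>hom_evf\<close> yields the
  law. One \<open>\<sigma>\<close> works for all structures, which later lets the same renamed
  identity be read in two of them.\<close>

lemma substitution:
  assumes \<tau>: "func \<tau> X Y" and y: "y \<in> elts Y"
  obtains \<sigma> where "func \<sigma> (terms \<Sigma> X) (terms \<Sigma> Y)"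
    "\<And>A w t. is_struct \<Sigma> A \<Longrightarrow> func w Y (univ A) \<Longrightarrow> t \<in> elts (terms \<Sigma> X) \<Longrightarrow>
      app (evf Y A w) (app \<sigma> t) = app (evf X A (tmap X w \<tau>)) t"
proof -
  \<comment> \<open>No relation holds in the structure of terms, so its evaluation maps preserve
    relations vacuously.\<close>
  have "definable_term (\<lambda>e. tapp (e 0) (e (Suc 0)))" "definable (\<lambda>e. False)" by (intro dfn)+
  from mk_struct[of tapp "\<lambda>_ _. False", OF this tvar_terms[OF y] tapp_terms] obtain M where
    M: "is_struct \<Sigma> M" "univ M = terms \<Sigma> Y"
    "\<And>f s. f \<in> elts (funcs \<Sigma>) \<Longrightarrow> func s (ar \<Sigma> f) (terms \<Sigma> Y) \<Longrightarrow> app (interp M f) s = tapp f s"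
    "\<And>r s. r \<in> elts (rels \<Sigma>) \<Longrightarrow> s \<in> elts (interp M r) \<longleftrightarrow> func s (ar \<Sigma> r) (terms \<Sigma> Y) \<and> False"
    by blast
  let ?v = "lam X (\<lambda>x. tvar (app \<tau> x))"
  have Tv: "definable_term (\<lambda>e. tvar (app \<tau> (e 0)))" by (intro dfn definable_term_app[OF func_fun_on[OF \<tau>]])
  have v: "func ?v X (univ M)"
    unfolding M(2) by (rule func_lam[OF Tv]) (intro tvar_terms func_app[OF \<tau>])
  show ?thesis
  proof (rule that[of "evf X M ?v"])
    show "func (evf X M ?v) (terms \<Sigma> X) (terms \<Sigma> Y)" using func_evf[OF M(1) v] M(2) by simp
    fix A w t
    assume A: "is_struct \<Sigma> A" and w: "func w Y (univ A)" and t: "t \<in> elts (terms \<Sigma> X)"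
    have hom: "is_hom \<Sigma> (evf Y A w) M A"
      by (rule is_homI) (use func_evf[OF A w] evf_tapp[OF A w] in \<open>simp_all add: M\<close>)
    have "tmap X (evf Y A w) ?v = tmap X w \<tau>"
      by (rule lam_cong) (simp add: app_lam[OF Tv] evf_tvar[OF A w] func_app[OF \<tau>])
    then show "app (evf Y A w) (app (evf X M ?v) t) = app (evf X A (tmap X w \<tau>)) t"
      using hom_evf[OF M(1) A hom v t] by simp
  qed
qed

section \<open>Substructures and generation\<close>

lemma ex_substruct:
  assumes A: "is_struct \<Sigma> A" and U: "elts U \<subseteq> elts (univ A)" "x \<in> elts U"
    and cl: "\<And>f s. f \<in> elts (funcs \<Sigma>) \<Longrightarrow> func s (ar \<Sigma> f) U \<Longrightarrow> app (interp A f) s \<in> elts U"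
  obtains B where "is_substruct \<Sigma> B A" "univ B = U"
proof -
  have s: "sapp (sinterp A f) s = app (interp A f) s" if "f \<in> elts (funcs \<Sigma>)" "func s (ar \<Sigma> f) U" for f s
    using sinterp_sapp[OF A that(1) func_mono[OF that(2) U(1)]] .
  have "definable_term (\<lambda>e. sapp (sinterp A (e 0)) (e (Suc 0)))" "definable (\<lambda>e. e (Suc 0) \<in> elts (sinterp A (e 0)))"
    by (intro dfn)+
  from mk_struct[of "\<lambda>f s. sapp (sinterp A f) s" "\<lambda>r s. s \<in> elts (sinterp A r)", OF this U(2)]
  obtain B where B: "is_struct \<Sigma> B" "univ B = U"
    "\<And>f s. f \<in> elts (funcs \<Sigma>) \<Longrightarrow> func s (ar \<Sigma> f) U \<Longrightarrow> app (interp B f) s = sapp (sinterp A f) s"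
    "\<And>r s. r \<in> elts (rels \<Sigma>) \<Longrightarrow> s \<in> elts (interp B r) \<longleftrightarrow> func s (ar \<Sigma> r) U \<and> s \<in> elts (sinterp A r)"
    using s cl by auto
  have "is_substruct \<Sigma> B A"
    unfolding is_substruct_def using A B U(1) s by (auto simp: elts_funs sinterp_eq)
  then show ?thesis using that B(2) by blast
qed

lemma substruct_hom:
  assumes "is_substruct \<Sigma> B A"
  shows "is_hom \<Sigma> (lam (univ B) (\<lambda>x. x)) B A"
proof -
  have B: "is_struct \<Sigma> B" and sub: "elts (univ B) \<subseteq> elts (univ A)"
    using assms by (simp_all add: is_substruct_def)
  have Tid: "definable_term (\<lambda>e. e 0)" by (rule definable_term_var)
  have fn: "func (lam (univ B) (\<lambda>x. x)) (univ B) (univ A)" using sub by (intro func_lam[OF Tid]) blast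
  have id: "tmap n (lam (univ B) (\<lambda>x. x)) s = s" if s: "func s n (univ B)" for n s
  proof -
    have "tmap n (lam (univ B) (\<lambda>x. x)) s = lam n (app s)"
      by (rule lam_cong) (simp add: app_lam[OF Tid] func_app[OF s])
    then show ?thesis using lam_app_id[OF func_fun_on[OF s]] by simp
  qed
  show ?thesis
  proof (rule is_homI[OF fn])
    show "app (lam (univ B) (\<lambda>x. x)) (app (interp B f) s) =
        app (interp A f) (tmap (ar \<Sigma> f) (lam (univ B) (\<lambda>x. x)) s)"
      if "f \<in> elts (funcs \<Sigma>)" "func s (ar \<Sigma> f) (univ B)" for f s
      using assms that id[OF that(2)] struct_fun_app[OF B that]
      by (simp add: is_substruct_def elts_funs app_lam[OF Tid])
    show "tmap (ar \<Sigma> r) (lam (univ B) (\<lambda>x. x)) s \<in> elts (interp A r)"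
      if "r \<in> elts (rels \<Sigma>)" "s \<in> elts (interp B r)" for r s
      using assms that id[OF struct_rel[OF B that]] struct_rel[OF B that]
      by (simp add: is_substruct_def elts_funs)
  qed
qed

lemma substruct_evf:
  assumes B: "is_substruct \<Sigma> B A" and v: "func v X (univ B)" and t: "t \<in> elts (terms \<Sigma> X)"
  shows "app (evf X B v) t = app (evf X A v) t"
proof -
  have s: "is_struct \<Sigma> A" "is_struct \<Sigma> B" using B by (simp_all add: is_substruct_def)
  have Tid: "definable_term (\<lambda>e. e 0)" by (rule definable_term_var)
  have "tmap X (lam (univ B) (\<lambda>x. x)) v = lam X (app v)"
    by (rule lam_cong) (simp add: app_lam[OF Tid] func_app[OF v])
  then have "tmap X (lam (univ B) (\<lambda>x. x)) v = v" using lam_app_id[OF func_fun_on[OF v]] by simp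
  then show ?thesis
    using hom_evf[OF s(2,1) substruct_hom[OF B] v t] func_app[OF func_evf[OF s(2) v] t]
    by (simp add: app_lam[OF Tid])
qed

text \<open>The range of the evaluation map is closed under the operations: terms denoting the
  finitely many arguments are selected by \<open>lift_tuple\<close>. The generator \<open>x\<close>
  makes it nonempty.\<close>

lemma generated_substruct:
  assumes A: "is_struct \<Sigma> A" and v: "func v X (univ A)" and x: "x \<in> elts X"
  obtains B where "is_substruct \<Sigma> B A" "func v X (univ B)"
    "elts (univ B) = app (evf X A v) ` elts (terms \<Sigma> X)"
proof -
  note e = func_evf[OF A v]
  have "isset (app (evf X A v) ` elts (terms \<Sigma> X))"
    by (intro isset_image definable_term_app[OF func_fun_on[OF e]] definable_term_var isset_elts)
  then obtain U where U: "elts U = app (evf X A v) ` elts (terms \<Sigma> X)" by (auto simp: isset_def)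
  have vU: "app v y \<in> elts U" if "y \<in> elts X" for y
    using evf_tvar[OF A v that] tvar_terms[OF that] unfolding U by (metis imageI)
  obtain B where B: "is_substruct \<Sigma> B A" "univ B = U"
  proof (rule ex_substruct[OF A, of U])
    show "elts U \<subseteq> elts (univ A)" using U func_app[OF e] by auto
    show "app v x \<in> elts U" by (rule vU[OF x])
    fix f s assume f: "f \<in> elts (funcs \<Sigma>)" and s: "func s (ar \<Sigma> f) U"
    have sA: "func s (ar \<Sigma> f) (univ A)" using U func_app[OF e] by (intro func_mono[OF s]) auto
    have "\<exists>t\<in>elts (terms \<Sigma> X). app (evf X A v) t = app s k" if "k \<in> elts (ar \<Sigma> f)" for k
      using func_app[OF s that] unfolding U by auto
    from lift_tuple[OF ar_func[OF f] e sA this] obtain s' where s': "func s' (ar \<Sigma> f) (terms \<Sigma> X)" "s = tmap (ar \<Sigma> f) (evf X A v) s'"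
      by blast
    then show "app (interp A f) s \<in> elts U"
      using evf_tapp[OF A v f s'(1)] tapp_terms[OF f s'(1)] unfolding U by (metis imageI)
  qed
  have "func v X (univ B)" using v vU B(2) by (simp add: func_def)
  then show ?thesis using that B U by blast
qed

text \<open>Transport of structure along an injection. The inverse is a homomorphism too, so the
  copy is isomorphic; this moves a structure onto a domain inside a prescribed set.\<close>

lemma copy_struct:
  assumes A: "is_struct \<Sigma> A" and j: "func j (univ A) Z"
    and inj: "\<And>x y. x \<in> elts (univ A) \<Longrightarrow> y \<in> elts (univ A) \<Longrightarrow> app j x = app j y \<Longrightarrow> x = y"
  obtains B j' where "is_struct \<Sigma> B" "elts (univ B) = app j ` elts (univ A)"
    "is_hom \<Sigma> j A B" "is_hom \<Sigma> j' B A" "\<And>x. x \<in> elts (univ A) \<Longrightarrow> app j' (app j x) = x"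
proof -
  have Tj: "definable_term t \<Longrightarrow> definable_term (\<lambda>e. app j (t e))" for t by (rule definable_term_app[OF func_fun_on[OF j]])
  have "isset (app j ` elts (univ A))" by (intro isset_image Tj dfn isset_elts)
  then obtain U where U: "elts U = app j ` elts (univ A)" by (auto simp: isset_def)
  let ?g = "\<lambda>y. THE x. x \<in> elts (univ A) \<and> app j x = y"
  have Tg: "definable_term (\<lambda>e. ?g (e 0))" by (rule definable_term_the) (intro dfn Tj, metis inj)
  have g: "?g (app j x) = x" if "x \<in> elts (univ A)" for x
    using that inj by (intro the_equality) auto
  define j' where "j' = lam U ?g"
  have j'j: "app j' (app j x) = x" if "x \<in> elts (univ A)" for x
    unfolding j'_def using that app_lam[OF Tg, of "app j x" U] g U by simp
  have j': "func j' U (univ A)"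
    unfolding j'_def by (rule func_lam[OF Tg]) (use g U in auto)
  have jj': "app j (app j' y) = y" if "y \<in> elts U" for y
    using that j'j unfolding U by auto
  have fj: "func j (univ A) U" using j U by (simp add: func_def)
  have Tj': "definable_term t \<Longrightarrow> definable_term (\<lambda>e. app j' (t e))" for t by (rule definable_term_app[OF func_fun_on[OF j']])
  let ?m = "\<lambda>c s. lam (ar \<Sigma> c) (\<lambda>k. app j' (sapp s k))"
  let ?F = "\<lambda>f s. app j (sapp (sinterp A f) (?m f s))"
  let ?R = "\<lambda>r s. ?m r s \<in> elts (sinterp A r)"
  have m: "?m c s = tmap (ar \<Sigma> c) j' s" if s: "func s (ar \<Sigma> c) U" for c s
    by (rule lam_cong) (simp add: sapp_eq[OF func_fun_on[OF s]])
  have F: "?F f s = app j (app (interp A f) (tmap (ar \<Sigma> f) j' s))"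
    if f: "f \<in> elts (funcs \<Sigma>)" and s: "func s (ar \<Sigma> f) U" for f s
    using sinterp_sapp[OF A f func_tmap[OF j' s]] by (simp add: m[OF s])
  obtain x where x: "x \<in> elts (univ A)" using struct_nonempty[OF A] by blast
  have "definable_term (\<lambda>e. ?F (e 0) (e (Suc 0)))" "definable (\<lambda>e. ?R (e 0) (e (Suc 0)))" by (intro dfn Tj Tj')+
  from mk_struct[of ?F ?R, OF this func_app[OF fj x]] obtain B where
    B: "is_struct \<Sigma> B" "univ B = U"
    "\<And>f s. f \<in> elts (funcs \<Sigma>) \<Longrightarrow> func s (ar \<Sigma> f) U \<Longrightarrow> app (interp B f) s = ?F f s"
    "\<And>r s. r \<in> elts (rels \<Sigma>) \<Longrightarrow> s \<in> elts (interp B r) \<longleftrightarrow> func s (ar \<Sigma> r) U \<and> ?R r s"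
    using F func_app[OF fj struct_fun_app[OF A]] func_tmap[OF j'] by metis
  have id: "tmap n j' (tmap n j s) = s" if s: "func s n (univ A)" for n s
  proof -
    have "tmap n j' (tmap n j s) = lam n (app s)"
      by (rule lam_cong) (simp add: app_tmap[OF j s] j'j func_app[OF s])
    then show ?thesis using lam_app_id[OF func_fun_on[OF s]] by simp
  qed
  show ?thesis
  proof (rule that[OF B(1) _ _ _ j'j])
    show "elts (univ B) = app j ` elts (univ A)" using B(2) U by simp
    show "is_hom \<Sigma> j A B"
    proof (rule is_homI)
      show "func j (univ A) (univ B)" using fj B(2) by simp
      show "app j (app (interp A f) s) = app (interp B f) (tmap (ar \<Sigma> f) j s)"
        if "f \<in> elts (funcs \<Sigma>)" "func s (ar \<Sigma> f) (univ A)" for f s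
        using B(3)[OF that(1) func_tmap[OF fj that(2)]] F[OF that(1) func_tmap[OF fj that(2)]]
        by (simp add: id[OF that(2)])
      show "tmap (ar \<Sigma> r) j s \<in> elts (interp B r)"
        if "r \<in> elts (rels \<Sigma>)" "s \<in> elts (interp A r)" for r s
        using that func_tmap[OF fj struct_rel[OF A that]] m[OF func_tmap[OF fj struct_rel[OF A that]]]
        by (simp add: B(4) id[OF struct_rel[OF A that]] sinterp_eq[OF A])
    qed
    show "is_hom \<Sigma> j' B A"
    proof (rule is_homI)
      show "func j' (univ B) (univ A)" using j' B(2) by simp
      show "app j' (app (interp B f) s) = app (interp A f) (tmap (ar \<Sigma> f) j' s)"
        if f: "f \<in> elts (funcs \<Sigma>)" and s: "func s (ar \<Sigma> f) (univ B)" for f s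
      proof -
        have s': "func s (ar \<Sigma> f) U" using s B(2) by simp
        show ?thesis
          unfolding B(3)[OF f s'] F[OF f s'] by (rule j'j[OF struct_fun_app[OF A f func_tmap[OF j' s']]])
      qed
      show "tmap (ar \<Sigma> r) j' s \<in> elts (interp A r)"
        if "r \<in> elts (rels \<Sigma>)" "s \<in> elts (interp B r)" for r s
        using that by (auto simp: B(4) sinterp_eq[OF A] m)
    qed
  qed
qed

section \<open>Products and their projections\<close>

text \<open>Without choice the Cartesian product of the domains might be empty. The element
  \<open>d\<close> is the explicit witness against this.\<close>

lemma ex_product:
  assumes G: "fun_on G I" "\<And>i. i \<in> elts I \<Longrightarrow> is_struct \<Sigma> (app G i)"
    and d: "fun_on d I" "\<And>i. i \<in> elts I \<Longrightarrow> app d i \<in> elts (univ (app G i))"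
  obtains P where "is_product \<Sigma> I G P"
proof -
  let ?U = "{x. fun_on x I \<and> (\<forall>i\<in>elts I. app x i \<in> elts (univ (app G i)))}"
  have TG: "definable_term t \<Longrightarrow> definable_term (\<lambda>e. app G (t e))" for t by (rule definable_term_app[OF G(1)])
  \<comment> \<open>With \<open>sapp\<close> the condition becomes definable in the variable
    \<open>x\<close>, as Separation requires.\<close>
  have U': "?U = {x. fun_on x I \<and> (\<forall>i\<in>elts I. sapp x i \<in> elts (univ (app G i)))}"
    by (auto simp: sapp_eq)
  have "isset (\<Union>i\<in>elts I. elts (univ (app G i)))" by (rule isset_UN) (simp_all, intro dfn TG)
  then obtain W where W: "elts W = (\<Union>i\<in>elts I. elts (univ (app G i)))" by (auto simp: isset_def)
  have "?U \<subseteq> elts (funs I W)" by (auto simp: elts_funs W func_def)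
  then have "isset ?U" by (rule isset_subset[OF isset_elts, rotated]) (unfold U', intro dfn TG)
  then obtain U where U: "elts U = ?U" by (auto simp: isset_def)
  let ?c = "\<lambda>f s i. lam (ar \<Sigma> f) (\<lambda>k. sapp (sapp s k) i)"
  let ?F = "\<lambda>f s. lam I (\<lambda>i. sapp (sinterp (app G i) f) (?c f s i))"
  let ?R = "\<lambda>r s. \<forall>i\<in>elts I. ?c r s i \<in> elts (sinterp (app G i) r)"
  have c: "?c f s i = coord (ar \<Sigma> f) s i" if "func s (ar \<Sigma> f) U" "i \<in> elts I" for f s i
    unfolding coord_def
    by (rule lam_cong) (use func_app[OF that(1)] that(2) in \<open>simp add: sapp_eq[OF func_fun_on[OF that(1)]] sapp_eq[of _ I] U\<close>)
  have cf: "func (?c f s i) (ar \<Sigma> f) (univ (app G i))" if s: "func s (ar \<Sigma> f) U" and i: "i \<in> elts I" for f s i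
  proof (rule func_lam)
    show "definable_term (\<lambda>e. sapp (sapp s (e 0)) i)" by (intro dfn)
    show "sapp (sapp s k) i \<in> elts (univ (app G i))" if "k \<in> elts (ar \<Sigma> f)" for k
      using func_app[OF s that] i by (simp add: sapp_eq[OF func_fun_on[OF s] that] sapp_eq[of _ I] U)
  qed
  have TFi: "definable_term (\<lambda>e. sapp (sinterp (app G (e 0)) f) (?c f s (e 0)))" for f s by (intro dfn TG)
  have val: "sapp (sinterp (app G i) f) (?c f s i) = app (interp (app G i) f) (coord (ar \<Sigma> f) s i)"
    if f: "f \<in> elts (funcs \<Sigma>)" and s: "func s (ar \<Sigma> f) U" and i: "i \<in> elts I" for f s i
    using sinterp_sapp[OF G(2)[OF i] f cf[OF s i]] c[OF s i] by simp
  have F: "?F f s = lam I (\<lambda>i. app (interp (app G i) f) (coord (ar \<Sigma> f) s i))"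
    if "f \<in> elts (funcs \<Sigma>)" "func s (ar \<Sigma> f) U" for f s
    by (rule lam_cong) (rule val[OF that])
  have dU: "d \<in> elts U" using d U by blast
  have cl: "?F f s \<in> elts U" if "f \<in> elts (funcs \<Sigma>)" "func s (ar \<Sigma> f) U" for f s
    using struct_fun_app[OF G(2) that(1) cf[OF that(2)]]
    by (simp add: U fun_on_lam[OF TFi] app_lam[OF TFi] sinterp_sapp[OF G(2) that(1) cf[OF that(2)]])
  have "definable_term (\<lambda>e. ?F (e 0) (e (Suc 0)))" "definable (\<lambda>e. ?R (e 0) (e (Suc 0)))" by (intro dfn TG)+
  from mk_struct[of ?F ?R, OF this dU cl] obtain P where P: "is_struct \<Sigma> P" "univ P = U"
    "\<And>f s. f \<in> elts (funcs \<Sigma>) \<Longrightarrow> func s (ar \<Sigma> f) U \<Longrightarrow> app (interp P f) s = ?F f s"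
    "\<And>r s. r \<in> elts (rels \<Sigma>) \<Longrightarrow> s \<in> elts (interp P r) \<longleftrightarrow> func s (ar \<Sigma> r) U \<and> ?R r s"
    by blast
  have "s \<in> elts (interp P r) \<longleftrightarrow> (\<forall>i\<in>elts I. coord (ar \<Sigma> r) s i \<in> elts (interp (app G i) r))"
    if "r \<in> elts (rels \<Sigma>)" "func s (ar \<Sigma> r) U" for r s
    using that c[OF that(2)] by (simp add: P(4) sinterp_eq[OF G(2)])
  then have "is_product \<Sigma> I G P"
    unfolding is_product_def using G P(1,2,3) U F by (simp add: elts_funs)
  then show ?thesis using that by blast
qed

lemma product_mem: "is_product \<Sigma> I G P \<Longrightarrow>
    x \<in> elts (univ P) \<longleftrightarrow> fun_on x I \<and> (\<forall>i\<in>elts I. app x i \<in> elts (univ (app G i)))"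
  by (simp add: is_product_def)

definition proj :: "'v \<Rightarrow> 'v \<Rightarrow> 'v" where
  "proj P i = lam (univ P) (\<lambda>x. sapp x i)"

lemma app_proj: "is_product \<Sigma> I G P \<Longrightarrow> i \<in> elts I \<Longrightarrow> x \<in> elts (univ P) \<Longrightarrow> app (proj P i) x = app x i"
  unfolding proj_def
  by (subst app_lam) (intro dfn, auto simp: product_mem sapp_eq)

lemma func_proj:
  assumes "is_product \<Sigma> I G P" "i \<in> elts I"
  shows "func (proj P i) (univ P) (univ (app G i))"
  unfolding proj_def
proof (rule func_lam)
  show "sapp x i \<in> elts (univ (app G i))" if "x \<in> elts (univ P)" for x
    using that assms by (auto simp: product_mem sapp_eq)
qed (intro dfn)

lemma coord_proj:
  assumes "is_product \<Sigma> I G P" "i \<in> elts I" "func s n (univ P)"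
  shows "coord n s i = tmap n (proj P i) s"
  unfolding coord_def by (rule lam_cong) (simp add: app_proj[OF assms(1,2)] func_app[OF assms(3)])

lemma proj_hom:
  assumes P: "is_product \<Sigma> I G P" and i: "i \<in> elts I"
  shows "is_hom \<Sigma> (proj P i) P (app G i)"
proof (rule is_homI[OF func_proj[OF P i]])
  have S: "is_struct \<Sigma> P" and SG: "\<And>j. j \<in> elts I \<Longrightarrow> is_struct \<Sigma> (app G j)" and fG: "fun_on G I"
    using P by (simp_all add: is_product_def)
  fix f s assume f: "f \<in> elts (funcs \<Sigma>)" and s: "func s (ar \<Sigma> f) (univ P)"
  \<comment> \<open>The coordinates are rewritten with \<open>sapp\<close> and
    \<open>sinterp\<close>, because \<open>app_lam\<close> demands definability in the index
    \<open>j\<close>.\<close>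
  let ?H = "\<lambda>j. sapp (sinterp (app G j) f) (lam (ar \<Sigma> f) (\<lambda>k. sapp (sapp s k) j))"
  have TH: "definable_term (\<lambda>e. ?H (e 0))" by (intro dfn definable_term_app[OF fG])
  have H: "?H j = app (interp (app G j) f) (coord (ar \<Sigma> f) s j)" if j: "j \<in> elts I" for j
  proof -
    have "lam (ar \<Sigma> f) (\<lambda>k. sapp (sapp s k) j) = coord (ar \<Sigma> f) s j"
      unfolding coord_def
      using func_app[OF s] j by (intro lam_cong)
        (simp add: product_mem[OF P] sapp_eq[OF func_fun_on[OF s]] sapp_eq[of _ I])
    then show ?thesis
      using sinterp_sapp[OF SG[OF j] f func_tmap[OF func_proj[OF P j] s]] coord_proj[OF P j s] by simp
  qed
  have "app (interp P f) s = lam I (\<lambda>j. app (interp (app G j) f) (coord (ar \<Sigma> f) s j))"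
    using P f s by (simp add: is_product_def elts_funs)
  also have "\<dots> = lam I ?H" by (rule lam_cong) (simp add: H)
  finally have "app (app (interp P f) s) i = ?H i" using app_lam[OF TH i] by simp
  then show "app (proj P i) (app (interp P f) s) = app (interp (app G i) f) (tmap (ar \<Sigma> f) (proj P i) s)"
    using H[OF i] by (simp add: app_proj[OF P i struct_fun_app[OF S f s]] coord_proj[OF P i s])
next
  have S: "is_struct \<Sigma> P" using P by (simp add: is_product_def)
  fix r s assume r: "r \<in> elts (rels \<Sigma>)" and s: "s \<in> elts (interp P r)"
  have fs: "func s (ar \<Sigma> r) (univ P)" by (rule struct_rel[OF S r s])
  then have "coord (ar \<Sigma> r) s i \<in> elts (interp (app G i) r)"
    using P i r s by (simp add: is_product_def elts_funs)
  then show "tmap (ar \<Sigma> r) (proj P i) s \<in> elts (interp (app G i) r)"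
    by (simp add: coord_proj[OF P i fs])
qed

section \<open>Finite sets of variables\<close>

text \<open>Finiteness of \<open>Y\<close> is witnessed by a coordinate map \<open>\<tau>\<close> with values below \<open>n\<close> and an
  inverse \<open>\<rho>\<close>, both total so that they can be composed with assignments.\<close>

definition finite_in :: "'v \<Rightarrow> 'v \<Rightarrow> bool" where
  "finite_in X Y \<longleftrightarrow> elts Y \<subseteq> elts X \<and> (\<exists>n\<in>elts omega. \<exists>\<tau> \<rho>. func \<tau> X omega \<and> func \<rho> omega X \<and>
    (\<forall>y\<in>elts Y. sapp \<tau> y \<in> elts n \<and> sapp \<rho> (sapp \<tau> y) = y))"

lemma definable_finite_in[dfn]: "definable_term t \<Longrightarrow> definable (\<lambda>e. finite_in X (t e))"
  by (rule definable_subst[of "\<lambda>Y e. finite_in X Y"], unfold finite_in_def) (intro dfn)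

lemma finite_inE:
  assumes "finite_in X Y"
  obtains n \<tau> \<rho> where "n \<in> elts omega" "func \<tau> X omega" "func \<rho> omega X"
    "\<And>y. y \<in> elts Y \<Longrightarrow> app \<tau> y \<in> elts n \<and> app \<rho> (app \<tau> y) = y"
proof -
  obtain n \<tau> \<rho> where *: "n \<in> elts omega" "func \<tau> X omega" "func \<rho> omega X"
    "\<forall>y\<in>elts Y. sapp \<tau> y \<in> elts n \<and> sapp \<rho> (sapp \<tau> y) = y" "elts Y \<subseteq> elts X"
    using assms unfolding finite_in_def by blast
  have "app \<tau> y \<in> elts n \<and> app \<rho> (app \<tau> y) = y" if "y \<in> elts Y" for y
  proof -
    have y: "y \<in> elts X" using that *(5) by blast
    show ?thesis
      using *(4) that sapp_eq[OF func_fun_on[OF *(2)] y] sapp_eq[OF func_fun_on[OF *(3)] func_app[OF *(2) y]]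
      by auto
  qed
  then show ?thesis using that *(1-3) by blast
qed

lemma finite_inI:
  assumes "n \<in> elts omega" "func \<tau> X omega" "func \<rho> omega X" "elts Y \<subseteq> elts X"
    and "\<And>y. y \<in> elts Y \<Longrightarrow> app \<tau> y \<in> elts n \<and> app \<rho> (app \<tau> y) = y"
  shows "finite_in X Y"
proof -
  have "sapp \<tau> y \<in> elts n \<and> sapp \<rho> (sapp \<tau> y) = y" if "y \<in> elts Y" for y
  proof -
    have y: "y \<in> elts X" using that assms(4) by blast
    show ?thesis
      using assms(5)[OF that] sapp_eq[OF func_fun_on[OF assms(2)] y]
        sapp_eq[OF func_fun_on[OF assms(3)] func_app[OF assms(2) y]]
      by simp
  qed
  then show ?thesis using assms(1-4) unfolding finite_in_def by blast
qed

lemma finite_in_empty: "x \<in> elts X \<Longrightarrow> finite_in X (setof {})"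
  by (rule finite_inI[OF zero_omega func_lam[of "\<lambda>_. setof {}"] func_lam[of "\<lambda>_. x"]]) (simp_all add: definable_term_const)

lemma finite_in_insert:
  assumes "finite_in X Y" "x \<in> elts X"
  shows "finite_in X (setof (insert x (elts Y)))"
proof (cases "x \<in> elts Y")
  case True
  then show ?thesis using assms(1) by (simp add: insert_absorb)
next
  case False
  obtain n \<tau> \<rho> where *: "n \<in> elts omega" "func \<tau> X omega" "func \<rho> omega X"
    "\<And>y. y \<in> elts Y \<Longrightarrow> app \<tau> y \<in> elts n \<and> app \<rho> (app \<tau> y) = y" using finite_inE[OF assms(1)] by blast
  have Y: "elts Y \<subseteq> elts X" using assms(1) by (simp add: finite_in_def)
  \<comment> \<open>The new element receives the number \<open>n\<close>. Old elements of
    \<open>Y\<close> have numbers in \<open>n\<close>, hence different from \<open>n\<close> by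
    \<open>not_mem_self\<close>, so \<open>\<rho>\<close> can be redefined at
    \<open>n\<close>.\<close>
  let ?\<tau> = "\<lambda>z. if z = x then n else app \<tau> z"
  let ?\<rho> = "\<lambda>k. if k = n then x else app \<rho> k"
  have T: "definable_term (\<lambda>e. ?\<tau> (e 0))" "definable_term (\<lambda>e. ?\<rho> (e 0))"
    by (intro definable_term_if dfn definable_term_app[OF func_fun_on[OF *(2)]] definable_term_app[OF func_fun_on[OF *(3)]])+
  have f: "func (lam X ?\<tau>) X omega" "func (lam omega ?\<rho>) omega X"
    by (rule func_lam[OF T(1)], use *(1) func_app[OF *(2)] in simp)
      (rule func_lam[OF T(2)], use assms(2) func_app[OF *(3)] in simp)
  show ?thesis
  proof (rule finite_inI[OF succ_omega[OF *(1)] f])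
    show "elts (setof (insert x (elts Y))) \<subseteq> elts X" using Y assms(2) by (simp add: elts_setof)
    fix y assume "y \<in> elts (setof (insert x (elts Y)))"
    then consider "y = x" | "y \<in> elts Y" "y \<noteq> x" by (auto simp: elts_setof)
    then show "app (lam X ?\<tau>) y \<in> elts (succ n) \<and> app (lam omega ?\<rho>) (app (lam X ?\<tau>) y) = y"
    proof cases
      case 1
      then show ?thesis using assms(2) *(1) by (simp add: app_lam[OF T(1)] app_lam[OF T(2)])
    next
      case 2
      then have "y \<in> elts X" using Y by blast
      moreover have "app \<tau> y \<noteq> n" using *(4)[OF 2(1)] not_mem_self by metis
      ultimately show ?thesis
        using 2 *(4)[OF 2(1)] func_app[OF *(2)] by (simp add: app_lam[OF T(1)] app_lam[OF T(2)])
    qed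
  qed
qed

text \<open>The starting set \<open>Y\<close> is quantified inside the induction, so that
  \<open>finite_extension\<close> can gather the variables of a compound term one argument after
  another.\<close>

lemma finite_in_term:
  assumes "t \<in> elts (terms \<Sigma> X)" "finite_in X Y"
  shows "\<exists>Z. finite_in X Z \<and> elts Y \<subseteq> elts Z \<and> t \<in> elts (terms \<Sigma> Z)"
proof -
  have "\<forall>Y. finite_in X Y \<longrightarrow> (\<exists>Z. finite_in X Z \<and> elts Y \<subseteq> elts Z \<and> t \<in> elts (terms \<Sigma> Z))"
    using assms(1)
  proof (induction t rule: terms_induct)
    case definable show ?case by (intro dfn)
  next
    case (tvar x)
    show ?case
    proof (intro allI impI)
      fix Y assume "finite_in X Y"
      then show "\<exists>Z. finite_in X Z \<and> elts Y \<subseteq> elts Z \<and> tvar x \<in> elts (terms \<Sigma> Z)"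
        by (intro exI[of _ "setof (insert x (elts Y))"]) (auto simp: elts_setof finite_in_insert tvar tvar_terms)
    qed
  next
    case (tapp f s)
    show ?case
    proof (intro allI impI)
      fix Y assume Y: "finite_in X Y"
      obtain Z where "finite_in X Z" "elts Y \<subseteq> elts Z" "\<And>k. k \<in> elts (ar \<Sigma> f) \<Longrightarrow> app s k \<in> elts (terms \<Sigma> Z)"
      proof (rule finite_extension[of "ar \<Sigma> f" "finite_in X" "\<lambda>k Z. app s k \<in> elts (terms \<Sigma> Z)" Y])
        show "definable (\<lambda>e. app s (e 0) \<in> elts (terms \<Sigma> (e (Suc 0))))"
          by (intro dfn definable_term_app[OF func_fun_on[OF tapp(2)]])
        show "definable (\<lambda>e. finite_in X (e 0))" by (intro dfn)
      qed (use Y ar_func[OF tapp(1)] tapp(3) terms_mono in blast)+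
      moreover from this have "func s (ar \<Sigma> f) (terms \<Sigma> Z)" using tapp(2) by (simp add: func_def)
      ultimately show "\<exists>Z. finite_in X Z \<and> elts Y \<subseteq> elts Z \<and> tapp f s \<in> elts (terms \<Sigma> Z)"
        using tapp_terms[OF tapp(1)] by blast
    qed
  qed
  then show ?thesis using assms(2) by blast
qed

lemma finite_in_terms:
  assumes "func s n (terms \<Sigma> X)" "n \<in> elts omega" "x \<in> elts X"
  obtains Z where "finite_in X Z" "func s n (terms \<Sigma> Z)"
proof -
  obtain Z where "finite_in X Z" "\<And>k. k \<in> elts n \<Longrightarrow> app s k \<in> elts (terms \<Sigma> Z)"
  proof (rule finite_extension[of n "finite_in X" "\<lambda>k Z. app s k \<in> elts (terms \<Sigma> Z)" "setof {}"])
    show "definable (\<lambda>e. app s (e 0) \<in> elts (terms \<Sigma> (e (Suc 0))))"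
      by (intro dfn definable_term_app[OF func_fun_on[OF assms(1)]])
    show "definable (\<lambda>e. finite_in X (e 0))" by (intro dfn)
    show "\<exists>Z. finite_in X Z \<and> elts Y \<subseteq> elts Z \<and> app s k \<in> elts (terms \<Sigma> Z)" if "k \<in> elts n" "finite_in X Y" for k Y
      using finite_in_term[OF func_app[OF assms(1) that(1)] that(2)] .
    show "finite_in X (setof {})" by (rule finite_in_empty[OF assms(3)])
  qed (use assms(2) terms_mono in blast)+
  then show ?thesis using that assms(1) by (simp add: func_def)
qed

lemma finite_in_two_terms:
  assumes "t \<in> elts (terms \<Sigma> X)" "u \<in> elts (terms \<Sigma> X)" "x \<in> elts X"
  obtains Z where "finite_in X Z" "t \<in> elts (terms \<Sigma> Z)" "u \<in> elts (terms \<Sigma> Z)"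
  using finite_in_term[OF assms(1) finite_in_empty[OF assms(3)]] finite_in_term[OF assms(2)] terms_mono by blast

section \<open>Varieties are closed\<close>

lemma sat_eqn: "sat_identity \<Sigma> A v (eqn t u) \<longleftrightarrow> app (evf omega A v) t = app (evf omega A v) u"
  by (auto simp: sat_identity_def eqn_def relatom_def eval_evf)

lemma sat_relatom: "sat_identity \<Sigma> A v (relatom r s) \<longleftrightarrow> tmap (ar \<Sigma> r) (evf omega A v) s \<in> elts (interp A r)"
  by (auto simp: sat_identity_def eqn_def relatom_def eval_evf)

text \<open>Lifting all of \<open>v\<close> through the surjection could take infinitely many
  choices. Only the values on \<open>Z\<close> matter: preimages are chosen for the numbers below
  \<open>n\<close> that code \<open>Z\<close>, and a variable with any other number receives the
  default \<open>a0\<close>.\<close>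

lemma lift_assignment:
  assumes A: "is_struct \<Sigma> A" and B: "is_struct \<Sigma> B" and h: "is_hom \<Sigma> h A B"
    and surj: "\<And>b. b \<in> elts (univ B) \<Longrightarrow> \<exists>a\<in>elts (univ A). app h a = b"
    and v: "func v X (univ B)" and Z: "finite_in X Z"
  obtains w where "func w X (univ A)"
    "\<And>t. t \<in> elts (terms \<Sigma> Z) \<Longrightarrow> app (evf X B v) t = app h (app (evf X A w) t)"
proof -
  note fh = hom_func[OF h]
  obtain n \<tau> \<rho> where *: "n \<in> elts omega" "func \<tau> X omega" "func \<rho> omega X"
    "\<And>y. y \<in> elts Z \<Longrightarrow> app \<tau> y \<in> elts n \<and> app \<rho> (app \<tau> y) = y" using finite_inE[OF Z] by blast
  have ZX: "elts Z \<subseteq> elts X" using Z by (simp add: finite_in_def)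
  have D: "definable (\<lambda>e. app h (e (Suc 0)) = app v (app \<rho> (e 0)))"
    by (intro dfn definable_term_app[OF func_fun_on[OF fh]] definable_term_app[OF func_fun_on[OF v]] definable_term_app[OF func_fun_on[OF *(3)]])
  have ex: "\<exists>a\<in>elts (univ A). app h a = app v (app \<rho> k)" if "k \<in> elts n" for k
    using that omega_trans[OF *(1)] by (intro surj func_app[OF v] func_app[OF *(3)]) blast
  obtain a where a: "func a n (univ A)" "\<And>k. k \<in> elts n \<Longrightarrow> app h (app a k) = app v (app \<rho> k)"
    using finite_choice[OF *(1), of "\<lambda>k a. app h a = app v (app \<rho> k)", OF D ex] by blast
  obtain a0 where a0: "a0 \<in> elts (univ A)" using struct_nonempty[OF A] by blast
  let ?w = "\<lambda>x. if app \<tau> x \<in> elts n then app a (app \<tau> x) else a0"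
  have Tw: "definable_term (\<lambda>e. ?w (e 0))"
    by (intro definable_term_if dfn definable_term_app[OF func_fun_on[OF a(1)]] definable_term_app[OF func_fun_on[OF *(2)]])
  have w: "func (lam X ?w) X (univ A)" by (rule func_lam[OF Tw]) (use a0 func_app[OF a(1)] in simp)
  show ?thesis
  proof (rule that[OF w])
    fix t assume t: "t \<in> elts (terms \<Sigma> Z)"
    have "app v y = app (tmap X h (lam X ?w)) y" if "y \<in> elts Z" for y
    proof -
      have y: "y \<in> elts X" using that ZX by blast
      show ?thesis using *(4)[OF that] a(2) by (simp add: app_tmap[OF fh w y] app_lam[OF Tw y])
    qed
    then have "app (evf X B v) t = app (evf X B (tmap X h (lam X ?w))) t"
      by (rule evf_agree[OF B v func_tmap[OF fh w] ZX _ t])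
    also have "\<dots> = app h (app (evf X A (lam X ?w)) t)"
      using hom_evf[OF A B h w] t terms_mono[OF ZX] by auto
    finally show "app (evf X B v) t = app h (app (evf X A (lam X ?w)) t)" .
  qed
qed

lemma models_hom_image:
  assumes "is_hom_image \<Sigma> B A" "is_identity \<Sigma> p" "models \<Sigma> A p"
  shows "models \<Sigma> B p"
  unfolding models_def
proof (intro allI impI)
  fix v assume v: "func v omega (univ B)"
  obtain h where A: "is_struct \<Sigma> A" and B: "is_struct \<Sigma> B" and h: "is_hom \<Sigma> h A B"
    and surj: "\<And>b. b \<in> elts (univ B) \<Longrightarrow> \<exists>a\<in>elts (univ A). app h a = b"
    using assms(1) unfolding is_hom_image_def by blast
  from assms(2) consider
    t u where "t \<in> elts (terms \<Sigma> omega)" "u \<in> elts (terms \<Sigma> omega)" "p = eqn t u"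
    | r s where "r \<in> elts (rels \<Sigma>)" "func s (ar \<Sigma> r) (terms \<Sigma> omega)" "p = relatom r s"
    by (auto simp: is_identity_def elts_funs)
  then show "sat_identity \<Sigma> B v p"
  proof cases
    case 1
    obtain Z where Z: "finite_in omega Z" "t \<in> elts (terms \<Sigma> Z)" "u \<in> elts (terms \<Sigma> Z)"
      using finite_in_two_terms[OF 1(1,2) zero_omega] by blast
    obtain w where w: "func w omega (univ A)"
      "\<And>t. t \<in> elts (terms \<Sigma> Z) \<Longrightarrow> app (evf omega B v) t = app h (app (evf omega A w) t)"
      using lift_assignment[OF A B h surj v Z(1)] by blast
    have "sat_identity \<Sigma> A w p" using assms(3) w(1) by (simp add: models_def)
    then show ?thesis using w(2) Z(2,3) by (simp add: 1(3) sat_eqn)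
  next
    case 2
    obtain Z where Z: "finite_in omega Z" "func s (ar \<Sigma> r) (terms \<Sigma> Z)"
      using finite_in_terms[OF 2(2) ar_rel[OF 2(1)] zero_omega] by blast
    obtain w where w: "func w omega (univ A)"
      "\<And>t. t \<in> elts (terms \<Sigma> Z) \<Longrightarrow> app (evf omega B v) t = app h (app (evf omega A w) t)"
      using lift_assignment[OF A B h surj v Z(1)] by blast
    have "sat_identity \<Sigma> A w p" using assms(3) w(1) by (simp add: models_def)
    then have "tmap (ar \<Sigma> r) h (tmap (ar \<Sigma> r) (evf omega A w) s) \<in> elts (interp B r)"
      unfolding 2(3) sat_relatom by (rule hom_rel[OF h 2(1)])
    moreover have "tmap (ar \<Sigma> r) h (tmap (ar \<Sigma> r) (evf omega A w) s) = tmap (ar \<Sigma> r) (evf omega B v) s"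
      by (rule lam_cong) (simp add: app_tmap[OF func_evf[OF A w(1)] 2(2)] w(2) func_app[OF Z(2)])
    ultimately show ?thesis by (simp add: 2(3) sat_relatom)
  qed
qed

lemma models_substruct:
  assumes B: "is_substruct \<Sigma> B A" and p: "is_identity \<Sigma> p" "models \<Sigma> A p"
  shows "models \<Sigma> B p"
  unfolding models_def
proof (intro allI impI)
  fix v assume v: "func v omega (univ B)"
  have SB: "is_struct \<Sigma> B" using B by (simp add: is_substruct_def)
  have "func v omega (univ A)" using B by (intro func_mono[OF v]) (simp add: is_substruct_def)
  then have A: "sat_identity \<Sigma> A v p" using p(2) by (simp add: models_def)
  from p(1) consider
    t u where "t \<in> elts (terms \<Sigma> omega)" "u \<in> elts (terms \<Sigma> omega)" "p = eqn t u"
    | r s where "r \<in> elts (rels \<Sigma>)" "func s (ar \<Sigma> r) (terms \<Sigma> omega)" "p = relatom r s"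
    by (auto simp: is_identity_def elts_funs)
  then show "sat_identity \<Sigma> B v p"
  proof cases
    case 1
    then show ?thesis using A by (simp add: sat_eqn substruct_evf[OF B v])
  next
    case 2
    have "tmap (ar \<Sigma> r) (evf omega B v) s = tmap (ar \<Sigma> r) (evf omega A v) s"
      by (rule lam_cong) (simp add: substruct_evf[OF B v] func_app[OF 2(2)])
    then show ?thesis
      using A B 2 func_tmap[OF func_evf[OF SB v] 2(2)] by (simp add: sat_relatom is_substruct_def elts_funs)
  qed
qed

text \<open>Projections are homomorphisms, so evaluation is coordinatewise, and so are equality and
  the relations of a product.\<close>

lemma models_product:
  assumes P: "is_product \<Sigma> I G P" and p: "is_identity \<Sigma> p" "\<And>i. i \<in> elts I \<Longrightarrow> models \<Sigma> (app G i) p"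
  shows "models \<Sigma> P p"
  unfolding models_def
proof (intro allI impI)
  fix v assume v: "func v omega (univ P)"
  have SP: "is_struct \<Sigma> P" and SG: "\<And>i. i \<in> elts I \<Longrightarrow> is_struct \<Sigma> (app G i)"
    using P by (simp_all add: is_product_def)
  note e = func_evf[OF SP v]
  have G: "sat_identity \<Sigma> (app G i) (tmap omega (proj P i) v) p" if "i \<in> elts I" for i
    using p(2)[OF that] func_tmap[OF func_proj[OF P that] v] by (simp add: models_def)
  have ev: "app (app (evf omega P v) t) i = app (evf omega (app G i) (tmap omega (proj P i) v)) t"
    if "i \<in> elts I" "t \<in> elts (terms \<Sigma> omega)" for i t
    using hom_evf[OF SP SG[OF that(1)] proj_hom[OF P that(1)] v that(2)]
    by (simp add: app_proj[OF P that(1) func_app[OF e that(2)]])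
  from p(1) consider
    t u where "t \<in> elts (terms \<Sigma> omega)" "u \<in> elts (terms \<Sigma> omega)" "p = eqn t u"
    | r s where "r \<in> elts (rels \<Sigma>)" "func s (ar \<Sigma> r) (terms \<Sigma> omega)" "p = relatom r s"
    by (auto simp: is_identity_def elts_funs)
  then show "sat_identity \<Sigma> P v p"
  proof cases
    case 1
    have "app (evf omega P v) t = app (evf omega P v) u"
    proof (rule fun_on_ext)
      show "fun_on (app (evf omega P v) t) I" "fun_on (app (evf omega P v) u) I"
        using func_app[OF e 1(1)] func_app[OF e 1(2)] by (simp_all add: product_mem[OF P])
      show "app (app (evf omega P v) t) i = app (app (evf omega P v) u) i" if "i \<in> elts I" for i
        using G[OF that] 1 by (simp add: ev[OF that] sat_eqn)
    qed
    then show ?thesis by (simp add: 1(3) sat_eqn)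
  next
    case 2
    have fs: "func (tmap (ar \<Sigma> r) (evf omega P v) s) (ar \<Sigma> r) (univ P)" by (rule func_tmap[OF e 2(2)])
    have "coord (ar \<Sigma> r) (tmap (ar \<Sigma> r) (evf omega P v) s) i \<in> elts (interp (app G i) r)"
      if "i \<in> elts I" for i
      using G[OF that] 2(3) hom_tmap_evf[OF SP SG[OF that] proj_hom[OF P that] v 2(2)]
      by (simp add: coord_proj[OF P that fs] sat_relatom)
    then show ?thesis using P 2(1,3) fs by (simp add: sat_relatom is_product_def elts_funs)
  qed
qed

lemma variety_closed:
  assumes "is_variety \<Sigma> K"
  shows "closed_hom_images \<Sigma> K \<and> closed_substructs \<Sigma> K \<and> closed_products \<Sigma> K"
proof -
  obtain \<Gamma> where \<Gamma>: "\<And>p. p \<in> elts \<Gamma> \<Longrightarrow> is_identity \<Sigma> p"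
    and K: "K = {A. is_struct \<Sigma> A \<and> (\<forall>p\<in>elts \<Gamma>. models \<Sigma> A p)}"
    using assms unfolding is_variety_def by blast
  have "closed_hom_images \<Sigma> K"
    unfolding closed_hom_images_def K using models_hom_image[OF _ \<Gamma>] by (auto simp: is_hom_image_def)
  moreover have "closed_substructs \<Sigma> K"
    unfolding closed_substructs_def K using models_substruct[OF _ \<Gamma>] by (auto simp: is_substruct_def)
  moreover have "closed_products \<Sigma> K"
    unfolding closed_products_def
  proof (intro allI impI)
    fix I G P assume *: "(\<forall>i\<in>elts I. app G i \<in> K) \<and> is_product \<Sigma> I G P"
    then have "is_struct \<Sigma> P" by (simp add: is_product_def)
    moreover have "models \<Sigma> P p" if "p \<in> elts \<Gamma>" for p
      using models_product[OF _ \<Gamma>[OF that], of I G P] * that unfolding K by blast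
    ultimately show "P \<in> K" unfolding K by blast
  qed
  ultimately show ?thesis by blast
qed

section \<open>Free structures\<close>

text \<open>Tuples of every finite length over \<open>a\<close> are subsets of the product of
  \<open>omega\<close> and \<open>a\<close>, so a single power set contains them all.\<close>

lemma tuples_bounded: "\<exists>Q. \<forall>n\<in>elts omega. \<forall>s. func s n a \<longrightarrow> s \<in> elts Q"
proof -
  have "isset {opair k y | k y. k \<in> elts omega \<and> y \<in> elts a}" by (rule isset_opairs) simp_all
  then obtain R where R: "elts R = {opair k y | k y. k \<in> elts omega \<and> y \<in> elts a}" by (auto simp: isset_def)
  obtain Q where Q: "elts Q = {z. elts z \<subseteq> elts R}" using isset_Pow[of R] by (auto simp: isset_def)
  have "s \<in> elts Q" if n: "n \<in> elts omega" and s: "func s n a" for n s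
  proof -
    have "p \<in> elts R" if "p \<in> elts s" for p
    proof -
      obtain k where "k \<in> elts n" "p = opair k (app s k)"
        using \<open>p \<in> elts s\<close> fun_on_opair[OF func_fun_on[OF s]] by blast
      then show ?thesis using omega_trans[OF n] func_app[OF s] by (auto simp: R)
    qed
    then show ?thesis by (auto simp: Q)
  qed
  then show ?thesis by blast
qed

text \<open>An interpretation is a set of tuples, or of pairs of a tuple and a value, and
  \<open>tuples_bounded\<close> bounds these uniformly over all symbols. Bounded domains therefore
  leave only a set of structures.\<close>

lemma structs_bounded: "\<exists>V. \<forall>B. is_struct \<Sigma> B \<and> elts (univ B) \<subseteq> elts W \<longrightarrow> B \<in> elts V"
proof -
  obtain Q where Q: "\<And>n s. n \<in> elts omega \<Longrightarrow> func s n W \<Longrightarrow> s \<in> elts Q" using tuples_bounded by blast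
  have "isset (elts Q \<union> {opair s y | s y. s \<in> elts Q \<and> y \<in> elts W})"
    by (intro isset_Un isset_opairs isset_elts)
  then obtain N where N: "elts N = elts Q \<union> {opair s y | s y. s \<in> elts Q \<and> y \<in> elts W}"
    by (auto simp: isset_def)
  obtain L where L: "elts L = {z. elts z \<subseteq> elts N}" using isset_Pow[of N] by (auto simp: isset_def)
  have "isset {opair a i | a i. a \<in> {z. elts z \<subseteq> elts W} \<and> i \<in> elts (funs Sym L)}"
    by (intro isset_opairs isset_Pow isset_elts)
  then obtain V where V: "elts V = {opair a i | a i. a \<in> {z. elts z \<subseteq> elts W} \<and> i \<in> elts (funs Sym L)}"
    by (auto simp: isset_def)
  have "B \<in> elts V" if B: "is_struct \<Sigma> B" and W: "elts (univ B) \<subseteq> elts W" for B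
  proof -
    obtain a i where ai: "B = opair a i" "fun_on i Sym" using B by (auto simp: is_struct_def)
    have "elts (interp B f) \<subseteq> elts N" if f: "f \<in> elts (funcs \<Sigma>)" for f
    proof
      fix p assume "p \<in> elts (interp B f)"
      then obtain s where s: "func s (ar \<Sigma> f) (univ B)" "p = opair s (app (interp B f) s)"
        using fun_on_opair[OF func_fun_on[OF struct_fun[OF B f]]] by (auto simp: elts_funs)
      then show "p \<in> elts N"
        using Q[OF ar_func[OF f] func_mono[OF s(1) W]] struct_fun_app[OF B f s(1)] W by (auto simp: N)
    qed
    moreover have "elts (interp B r) \<subseteq> elts N" if r: "r \<in> elts (rels \<Sigma>)" for r
    proof
      fix s assume "s \<in> elts (interp B r)"
      then show "s \<in> elts N" using Q[OF ar_rel[OF r] func_mono[OF struct_rel[OF B r] W]] by (simp add: N)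
    qed
    ultimately have "func i Sym L" using ai by (auto simp: func_def elts_Sym L)
    then show ?thesis using ai(1) W by (auto simp: V elts_funs)
  qed
  then show ?thesis by blast
qed

definition psnd :: "'v \<Rightarrow> 'v" where
  "psnd p = (THE v. \<exists>B. p = opair B v)"

lemma psnd_opair[simp]: "psnd (opair B v) = v"
  by (simp add: psnd_def)

lemma definable_term_psnd[dfn]: "definable_term t \<Longrightarrow> definable_term (\<lambda>e. psnd (t e))"
  by (rule definable_term_subst[of psnd], unfold psnd_def, rule definable_term_the) (intro dfn, auto)

text \<open>Up to isomorphism, a structure generated by \<open>X\<close> has sets of terms as elements: an element
  corresponds to the set of terms that denote it. Therefore a set of pairs \<open>(B, v)\<close> suffices as
  index set of the product.\<close>

lemma free_structure:
  assumes K: "is_class K" "\<And>A. A \<in> K \<Longrightarrow> is_struct \<Sigma> A"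
    and closed: "closed_hom_images \<Sigma> K" "closed_substructs \<Sigma> K" "closed_products \<Sigma> K"
    and x0: "x0 \<in> elts X"
  obtains F \<eta> where "F \<in> K" "func \<eta> X (univ F)" "elts (univ F) = app (evf X F \<eta>) ` elts (terms \<Sigma> X)"
    "\<And>C w. C \<in> K \<Longrightarrow> func w X (univ C) \<Longrightarrow> \<exists>g. is_hom \<Sigma> g F C \<and> (\<forall>x\<in>elts X. app g (app \<eta> x) = app w x)"
proof -
  obtain W where W: "elts W = {z. elts z \<subseteq> elts (terms \<Sigma> X)}" using isset_Pow[of "terms \<Sigma> X"] by (auto simp: isset_def)
  obtain V where V: "\<And>B. is_struct \<Sigma> B \<Longrightarrow> elts (univ B) \<subseteq> elts W \<Longrightarrow> B \<in> elts V"
    using structs_bounded by blast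
  define I where "I = setof {p. \<exists>B v. p = opair B v \<and> B \<in> K \<and> elts (univ B) \<subseteq> elts W \<and> func v X (univ B)}"
  \<comment> \<open>\<open>structs_bounded\<close> confines \<open>B\<close> and
    \<open>funs X W\<close> confines \<open>v\<close>; Separation applies because \<open>K\<close>
    is a definable class.\<close>
  have elts_I: "elts I = {p. \<exists>B v. p = opair B v \<and> B \<in> K \<and> elts (univ B) \<subseteq> elts W \<and> func v X (univ B)}"
    unfolding I_def
  proof (rule elts_setof, rule isset_subset)
    show "isset {opair B v | B v. B \<in> elts V \<and> v \<in> elts (funs X W)}" by (intro isset_opairs isset_elts)
    show "{p. \<exists>B v. p = opair B v \<and> B \<in> K \<and> elts (univ B) \<subseteq> elts W \<and> func v X (univ B)}
        \<subseteq> {opair B v | B v. B \<in> elts V \<and> v \<in> elts (funs X W)}"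
      using V K(2) by (auto simp: elts_funs intro: func_mono)
  qed (intro dfn definable_class[OF K(1)])
  have memI: "opair B v \<in> elts I \<longleftrightarrow> B \<in> K \<and> elts (univ B) \<subseteq> elts W \<and> func v X (univ B)" for B v
    by (simp add: elts_I)
  \<comment> \<open>An index is a pair \<open>opair B v\<close>, and \<open>univ\<close> is the
    first projection of a pair, so here it returns the structure \<open>B\<close> itself and not a
    domain.\<close>
  define G where "G = lam I univ"
  have TG: "definable_term (\<lambda>e. univ (e 0))" by (intro dfn)
  have fG: "fun_on G I" unfolding G_def by (rule fun_on_lam[OF TG])
  have G: "app G p \<in> K \<and> func (psnd p) X (univ (app G p))" if "p \<in> elts I" for p
    using that app_lam[OF TG that] unfolding G_def elts_I by auto
  have SG: "is_struct \<Sigma> (app G p)" if "p \<in> elts I" for p using G[OF that] K(2) by blast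
  \<comment> \<open>The diagonal: at the index \<open>opair B v\<close> the generator
    \<open>x\<close> has the coordinate \<open>app v x\<close>. Its value at \<open>x0\<close>
    proves the product nonempty without choice.\<close>
  let ?\<delta> = "\<lambda>x. lam I (\<lambda>p. sapp (psnd p) x)"
  have T\<delta>': "definable_term (\<lambda>e. sapp (psnd (e 0)) x)" for x by (intro dfn)
  have \<delta>_app: "app (?\<delta> x) p = app (psnd p) x" if "p \<in> elts I" "x \<in> elts X" for p x
    using app_lam[OF T\<delta>' that(1)] sapp_eq[OF func_fun_on] G[OF that(1)] that(2) by metis
  have \<delta>: "fun_on (?\<delta> x) I" "p \<in> elts I \<Longrightarrow> app (?\<delta> x) p \<in> elts (univ (app G p))" if "x \<in> elts X" for x p
    using fun_on_lam[OF T\<delta>'] \<delta>_app that G func_app by metis+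
  obtain P where P: "is_product \<Sigma> I G P" using ex_product[OF fG SG \<delta>[OF x0]] by blast
  have SP: "is_struct \<Sigma> P" using P by (simp add: is_product_def)
  have "P \<in> K" using closed(3) P G unfolding closed_products_def by blast
  have T\<delta>: "definable_term (\<lambda>e. ?\<delta> (e 0))" by (intro dfn)
  define \<eta> where "\<eta> = lam X ?\<delta>"
  have \<eta>P: "func \<eta> X (univ P)"
    unfolding \<eta>_def by (rule func_lam[OF T\<delta>]) (use \<delta> in \<open>simp add: product_mem[OF P]\<close>)
  obtain F where F: "is_substruct \<Sigma> F P" "func \<eta> X (univ F)"
    "elts (univ F) = app (evf X P \<eta>) ` elts (terms \<Sigma> X)"
    using generated_substruct[OF SP \<eta>P x0] by blast
  have SF: "is_struct \<Sigma> F" and FP: "elts (univ F) \<subseteq> elts (univ P)"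
    using F(1) by (simp_all add: is_substruct_def)
  have "F \<in> K" using \<open>P \<in> K\<close> closed(2) F(1) unfolding closed_substructs_def by blast
  have Tid: "definable_term (\<lambda>e. e 0)" by (rule definable_term_var)
  have universal: "\<exists>g. is_hom \<Sigma> g F C \<and> (\<forall>x\<in>elts X. app g (app \<eta> x) = app w x)"
    if C: "C \<in> K" and w: "func w X (univ C)" for C w
  proof -
    note SC = K(2)[OF C]
    \<comment> \<open>\<open>C\<close> may be arbitrarily large; passing to the part generated by
      \<open>w\<close> makes every element the value of a term over \<open>X\<close>.\<close>
    obtain C' where C': "is_substruct \<Sigma> C' C" "func w X (univ C')"
      "elts (univ C') = app (evf X C w) ` elts (terms \<Sigma> X)"
      using generated_substruct[OF SC w x0] by blast
    have SC': "is_struct \<Sigma> C'" using C'(1) by (simp add: is_substruct_def)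
    have "C' \<in> K" using C closed(2) C'(1) unfolding closed_substructs_def by blast
    \<comment> \<open>Taking the whole set of terms that denote \<open>c\<close> is canonical and
      avoids selecting one of them. The set is nonempty for \<open>c\<close> in \<open>C'\<close>,
      which makes the map injective there.\<close>
    let ?j = "\<lambda>c. setof {t \<in> elts (terms \<Sigma> X). app (evf X C w) t = c}"
    have Te: "definable_term t \<Longrightarrow> definable_term (\<lambda>e. app (evf X C w) (t e))" for t
      by (rule definable_term_app[OF func_fun_on[OF func_evf[OF SC w]]])
    have "definable (\<lambda>e. app (evf X C w) (e 0) = c)" for c by (intro dfn Te)
    then have elts_j: "elts (?j c) = {t \<in> elts (terms \<Sigma> X). app (evf X C w) t = c}" for c
      by (intro elts_setof isset_sep)
    have Tj: "definable_term (\<lambda>e. ?j (e 0))" by (intro dfn Te)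
    define j where "j = lam (univ C') ?j"
    have j: "func j (univ C') W" unfolding j_def by (rule func_lam[OF Tj]) (auto simp: W elts_j)
    have j_inj: "c = d" if c: "c \<in> elts (univ C')" and d: "d \<in> elts (univ C')" and "app j c = app j d" for c d
    proof -
      have "elts (?j c) = elts (?j d)" using that by (simp add: j_def app_lam[OF Tj])
      moreover obtain t where "t \<in> elts (terms \<Sigma> X)" "app (evf X C w) t = c" using c unfolding C'(3) by blast
      ultimately show ?thesis unfolding elts_j by blast
    qed
    obtain B j' where B: "is_struct \<Sigma> B" "elts (univ B) = app j ` elts (univ C')"
      "is_hom \<Sigma> j C' B" "is_hom \<Sigma> j' B C'" "\<And>x. x \<in> elts (univ C') \<Longrightarrow> app j' (app j x) = x"
      using copy_struct[OF SC' j j_inj] by blast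
    have "is_hom_image \<Sigma> B C'" unfolding is_hom_image_def using B(1-3) SC' by auto
    then have "B \<in> K" using \<open>C' \<in> K\<close> closed(1) unfolding closed_hom_images_def by blast
    define v where "v = tmap X j w"
    have v: "func v X (univ B)" unfolding v_def by (rule func_tmap[OF hom_func[OF B(3)] C'(2)])
    define p where "p = opair B v"
    have p: "p \<in> elts I" unfolding p_def memI using \<open>B \<in> K\<close> v B(2) func_app[OF j] by auto
    have Gp: "app G p = B" unfolding G_def app_lam[OF TG p] by (simp add: p_def)
    have pr: "is_hom \<Sigma> (proj P p) P B" using proj_hom[OF P p] Gp by simp
    let ?iF = "lam (univ F) (\<lambda>x. x)" and ?iC = "lam (univ C') (\<lambda>x. x)"
    note iF = substruct_hom[OF F(1)] and iC = substruct_hom[OF C'(1)]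
    \<comment> \<open>The required homomorphism is the composite from \<open>F\<close> into
      \<open>P\<close>, by the projection at \<open>p\<close> to the copy \<open>B\<close>, back to
      \<open>C'\<close> by \<open>j'\<close>, and into \<open>C\<close>.\<close>
    let ?g1 = "tmap (univ F) (proj P p) ?iF" and ?g2 = "tmap (univ B) ?iC j'"
    have g1: "is_hom \<Sigma> ?g1 F B" by (rule hom_comp[OF SF iF pr])
    have g2: "is_hom \<Sigma> ?g2 B C" by (rule hom_comp[OF B(1,4) iC])
    have "app (tmap (univ F) ?g2 ?g1) (app \<eta> x) = app w x" if x: "x \<in> elts X" for x
    proof -
      have \<eta>x: "app \<eta> x \<in> elts (univ F)" by (rule func_app[OF F(2) x])
      then have \<eta>xP: "app \<eta> x \<in> elts (univ P)" using FP by blast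
      have "app ?g1 (app \<eta> x) = app (app \<eta> x) p"
        by (simp add: app_tmap[OF hom_func[OF pr] hom_func[OF iF] \<eta>x] app_lam[OF Tid \<eta>x] app_proj[OF P p \<eta>xP])
      also have "\<dots> = app v x" using \<delta>_app[OF p x] by (simp add: \<eta>_def app_lam[OF T\<delta> x] p_def)
      finally have 1: "app ?g1 (app \<eta> x) = app j (app w x)"
        unfolding v_def app_tmap[OF j C'(2) x] .
      have jw: "app j (app w x) \<in> elts (univ B)" using B(2) func_app[OF C'(2) x] by blast
      have "app ?g2 (app j (app w x)) = app w x"
        using func_app[OF C'(2) x]
        by (simp add: app_tmap[OF hom_func[OF iC] hom_func[OF B(4)] jw] B(5) app_lam[OF Tid])
      then show ?thesis
        by (simp add: app_tmap[OF hom_func[OF g2] hom_func[OF g1] \<eta>x] 1)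
    qed
    then show ?thesis using hom_comp[OF SF g1 g2] by blast
  qed
  have "elts (univ F) = app (evf X F \<eta>) ` elts (terms \<Sigma> X)"
    unfolding F(3) by (intro image_cong) (simp_all add: substruct_evf[OF F(1,2)])
  then show ?thesis using that \<open>F \<in> K\<close> F(2) universal by blast
qed

section \<open>Identities of the generators and the converse direction\<close>

lemma definable_term_eqn[dfn]: "definable_term t \<Longrightarrow> definable_term s \<Longrightarrow> definable_term (\<lambda>e. eqn (t e) (s e))"
  unfolding eqn_def by (intro dfn)

lemma definable_term_relatom[dfn]: "definable_term t \<Longrightarrow> definable_term s \<Longrightarrow> definable_term (\<lambda>e. relatom (t e) (s e))"
  unfolding relatom_def by (intro dfn)

text \<open>Codes of identities are bounded by pairs of terms and by relation symbols with tuples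
  from \<open>tuples_bounded\<close>. Truth under the single assignment \<open>\<eta>\<close> is
  definable because the evaluation map is a fixed parameter.\<close>

lemma generic_identities:
  assumes F: "is_struct \<Sigma> F" and \<eta>: "func \<eta> omega (univ F)"
  obtains \<Gamma> where "\<And>p. p \<in> elts \<Gamma> \<longleftrightarrow> is_identity \<Sigma> p \<and> sat_identity \<Sigma> F \<eta> p"
proof -
  let ?T = "terms \<Sigma> omega" and ?e = "evf omega F \<eta>"
  note e = func_evf[OF F \<eta>]
  let ?Eq = "{p. \<exists>t\<in>elts ?T. \<exists>u\<in>elts ?T. p = eqn t u \<and> app ?e t = app ?e u}"
  let ?Rel = "{p. \<exists>r\<in>elts (rels \<Sigma>). \<exists>s\<in>elts (funs (ar \<Sigma> r) ?T). p = relatom r s \<and>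
    lam (ar \<Sigma> r) (\<lambda>k. app ?e (sapp s k)) \<in> elts (interp F r)}"
  obtain Q where Q: "\<And>n s. n \<in> elts omega \<Longrightarrow> func s n ?T \<Longrightarrow> s \<in> elts Q" using tuples_bounded by blast
  have 1: "isset {opair z q | z q. z \<in> {setof {}} \<and> q \<in> {opair t u | t u. t \<in> elts ?T \<and> u \<in> elts ?T}}"
    by (intro isset_opairs isset_elts isset_singleton)
  have 2: "?Eq \<subseteq> {opair z q | z q. z \<in> {setof {}} \<and> q \<in> {opair t u | t u. t \<in> elts ?T \<and> u \<in> elts ?T}}"
    by (auto simp: eqn_def)
  have 3: "definable (\<lambda>e. e 0 \<in> ?Eq)" by (intro dfn definable_term_app[OF func_fun_on[OF e]])
  have Eq: "isset ?Eq" by (rule isset_subset[OF 1 3 2])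
  have 1: "isset {opair z q | z q. z \<in> {succ (setof {})} \<and> q \<in> {opair r s | r s. r \<in> elts (rels \<Sigma>) \<and> s \<in> elts Q}}"
    by (intro isset_opairs isset_elts isset_singleton)
  have 2: "?Rel \<subseteq> {opair z q | z q. z \<in> {succ (setof {})} \<and> q \<in> {opair r s | r s. r \<in> elts (rels \<Sigma>) \<and> s \<in> elts Q}}"
    by (auto simp: relatom_def elts_funs intro: Q[OF ar_rel])
  have 3: "definable (\<lambda>e. e 0 \<in> ?Rel)" by (intro dfn definable_term_app[OF func_fun_on[OF e]] definable_term_interp[OF F])
  have Rel: "isset ?Rel" by (rule isset_subset[OF 1 3 2])
  have "lam (ar \<Sigma> r) (\<lambda>k. app ?e (sapp s k)) = tmap (ar \<Sigma> r) ?e s" if "func s (ar \<Sigma> r) ?T" for r s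
    by (rule lam_cong) (simp add: sapp_eq[OF func_fun_on[OF that]])
  then have "p \<in> ?Eq \<union> ?Rel \<longleftrightarrow> is_identity \<Sigma> p \<and> sat_identity \<Sigma> F \<eta> p" for p
    unfolding is_identity_def by (auto simp: elts_funs sat_eqn sat_relatom)
  then show ?thesis using that[of "setof (?Eq \<union> ?Rel)"] elts_setof[OF isset_Un[OF Eq Rel]] by simp
qed

lemma closed_variety:
  assumes K: "is_class K" "\<And>A. A \<in> K \<Longrightarrow> is_struct \<Sigma> A"
    and closed: "closed_hom_images \<Sigma> K" "closed_substructs \<Sigma> K" "closed_products \<Sigma> K"
  shows "is_variety \<Sigma> K"
proof -
  obtain F0 \<eta>0 where F0: "F0 \<in> K" "func \<eta>0 omega (univ F0)"
    "elts (univ F0) = app (evf omega F0 \<eta>0) ` elts (terms \<Sigma> omega)"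
    and univ0: "\<And>C w. C \<in> K \<Longrightarrow> func w omega (univ C) \<Longrightarrow>
      \<exists>g. is_hom \<Sigma> g F0 C \<and> (\<forall>x\<in>elts omega. app g (app \<eta>0 x) = app w x)"
    using free_structure[OF K closed zero_omega] by blast
  have S0: "is_struct \<Sigma> F0" by (rule K(2)[OF F0(1)])
  let ?e0 = "evf omega F0 \<eta>0"
  obtain \<Gamma> where \<Gamma>: "\<And>p. p \<in> elts \<Gamma> \<longleftrightarrow> is_identity \<Sigma> p \<and> sat_identity \<Sigma> F0 \<eta>0 p"
    using generic_identities[OF S0 F0(2)] by blast
  \<comment> \<open>An arbitrary assignment \<open>v\<close> is the composite of
    \<open>\<eta>0\<close> with a homomorphism out of the free \<open>F0\<close>, and homomorphisms
    preserve equations and relations between values of terms.\<close>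
  have sound: "models \<Sigma> B p" if B: "B \<in> K" and p: "p \<in> elts \<Gamma>" for B p
    unfolding models_def
  proof (intro allI impI)
    fix v assume v: "func v omega (univ B)"
    note SB = K(2)[OF B]
    obtain g where g: "is_hom \<Sigma> g F0 B" "\<forall>x\<in>elts omega. app g (app \<eta>0 x) = app v x"
      using univ0[OF B v] by blast
    have "tmap omega g \<eta>0 = lam omega (app v)" by (rule lam_cong) (simp add: g(2))
    then have gv: "tmap omega g \<eta>0 = v" using lam_app_id[OF func_fun_on[OF v]] by simp
    have F: "sat_identity \<Sigma> F0 \<eta>0 p" using p \<Gamma> by blast
    have "is_identity \<Sigma> p" using p \<Gamma> by blast
    then consider
      t u where "t \<in> elts (terms \<Sigma> omega)" "u \<in> elts (terms \<Sigma> omega)" "p = eqn t u"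
      | r s where "r \<in> elts (rels \<Sigma>)" "func s (ar \<Sigma> r) (terms \<Sigma> omega)" "p = relatom r s"
      by (auto simp: is_identity_def elts_funs)
    then show "sat_identity \<Sigma> B v p"
    proof cases
      case 1
      have "app (evf omega B v) x = app g (app ?e0 x)" if "x \<in> elts (terms \<Sigma> omega)" for x
        using hom_evf[OF S0 SB g(1) F0(2) that] gv by simp
      then show ?thesis using F 1 by (simp add: sat_eqn)
    next
      case 2
      have "tmap (ar \<Sigma> r) g (tmap (ar \<Sigma> r) ?e0 s) \<in> elts (interp B r)"
        using F unfolding 2(3) sat_relatom by (rule hom_rel[OF g(1) 2(1)])
      then show ?thesis
        using hom_tmap_evf[OF S0 SB g(1) F0(2) 2(2)] gv by (simp add: 2(3) sat_relatom)
    qed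
  qed
  have complete: "A \<in> K" if SA: "is_struct \<Sigma> A" and A: "\<And>p. p \<in> elts \<Gamma> \<Longrightarrow> models \<Sigma> A p" for A
  proof -
    let ?X = "univ A"
    obtain x0 where x0: "x0 \<in> elts ?X" using struct_nonempty[OF SA] by blast
    obtain F \<eta> where F: "F \<in> K" "func \<eta> ?X (univ F)" "elts (univ F) = app (evf ?X F \<eta>) ` elts (terms \<Sigma> ?X)"
      and univF: "\<And>C w. C \<in> K \<Longrightarrow> func w ?X (univ C) \<Longrightarrow>
        \<exists>g. is_hom \<Sigma> g F C \<and> (\<forall>x\<in>elts ?X. app g (app \<eta> x) = app w x)"
      using free_structure[OF K closed x0] by blast
    have SF: "is_struct \<Sigma> F" by (rule K(2)[OF F(1)])
    have Tid: "definable_term (\<lambda>e. e 0)" by (rule definable_term_var)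
    \<comment> \<open>The elements of \<open>A\<close> serve as variables that denote
      themselves.\<close>
    define id where "id = lam ?X (\<lambda>x. x)"
    have id: "func id ?X ?X" unfolding id_def by (rule func_lam[OF Tid])
    have id_app: "app id x = x" if "x \<in> elts ?X" for x unfolding id_def by (rule app_lam[OF Tid that])
    define e where "e = evf ?X F \<eta>"
    define a where "a = evf ?X A id"
    have e: "func e (terms \<Sigma> ?X) (univ F)" unfolding e_def by (rule func_evf[OF SF F(2)])
    have a: "func a (terms \<Sigma> ?X) ?X" unfolding a_def by (rule func_evf[OF SA id])
    \<comment> \<open>The homomorphism \<open>g\<close> carries what holds in \<open>F\<close> to
      the renamed statement in \<open>F0\<close>, so the renamed identity belongs to
      \<open>\<Gamma>\<close>; in \<open>A\<close> the assignment \<open>\<rho>\<close> undoes the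
      renaming. Collisions of \<open>\<tau>\<close> outside \<open>Z\<close> are harmless:
      \<open>g\<close> exists for every \<open>\<tau>\<close>, and \<open>\<rho>\<close> only has to
      invert it for terms over \<open>Z\<close>.\<close>
    have transfer: "\<exists>\<sigma> g \<rho>. func \<sigma> (terms \<Sigma> ?X) (terms \<Sigma> omega) \<and> is_hom \<Sigma> g F F0 \<and> func \<rho> omega ?X \<and>
        (\<forall>t\<in>elts (terms \<Sigma> ?X). app ?e0 (app \<sigma> t) = app g (app e t)) \<and>
        (\<forall>t\<in>elts (terms \<Sigma> Z). app (evf omega A \<rho>) (app \<sigma> t) = app a t)"
      if Z: "finite_in ?X Z" for Z
    proof -
      have ZX: "elts Z \<subseteq> elts ?X" using Z by (simp add: finite_in_def)
      obtain n \<tau> \<rho> where \<tau>: "func \<tau> ?X omega" and \<rho>: "func \<rho> omega ?X"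
        and inv: "\<And>y. y \<in> elts Z \<Longrightarrow> app \<rho> (app \<tau> y) = y" using finite_inE[OF Z] by metis
      obtain \<sigma> where \<sigma>: "func \<sigma> (terms \<Sigma> ?X) (terms \<Sigma> omega)"
        "\<And>B w t. is_struct \<Sigma> B \<Longrightarrow> func w omega (univ B) \<Longrightarrow> t \<in> elts (terms \<Sigma> ?X) \<Longrightarrow>
          app (evf omega B w) (app \<sigma> t) = app (evf ?X B (tmap ?X w \<tau>)) t"
        using substitution[OF \<tau> zero_omega] by blast
      obtain g where g: "is_hom \<Sigma> g F F0" "\<forall>x\<in>elts ?X. app g (app \<eta> x) = app (tmap ?X \<eta>0 \<tau>) x"
        using univF[OF F0(1) func_tmap[OF F0(2) \<tau>]] by blast
      have "tmap ?X g \<eta> = tmap ?X \<eta>0 \<tau>"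
        by (rule lam_cong) (simp add: g(2) app_tmap[OF F0(2) \<tau>])
      then have "app ?e0 (app \<sigma> t) = app g (app e t)" if "t \<in> elts (terms \<Sigma> ?X)" for t
        using \<sigma>(2)[OF S0 F0(2) that] hom_evf[OF SF S0 g(1) F(2) that] by (simp add: e_def)
      moreover have "app (evf omega A \<rho>) (app \<sigma> t) = app a t" if "t \<in> elts (terms \<Sigma> Z)" for t
      proof -
        have "app (tmap ?X \<rho> \<tau>) y = app id y" if "y \<in> elts Z" for y
        proof -
          have "y \<in> elts ?X" using that ZX by blast
          then show ?thesis by (simp add: app_tmap[OF \<rho> \<tau>] id_app inv[OF that])
        qed
        then have "app (evf ?X A (tmap ?X \<rho> \<tau>)) t = app a t"
          unfolding a_def by (rule evf_agree[OF SA func_tmap[OF \<rho> \<tau>] id ZX _ that])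
        moreover have "t \<in> elts (terms \<Sigma> ?X)" using that terms_mono[OF ZX] by blast
        ultimately show ?thesis using \<sigma>(2)[OF SA \<rho>] by simp
      qed
      ultimately show ?thesis using \<sigma>(1) g(1) \<rho> by blast
    qed
    have eq: "app a t = app a u"
      if t: "t \<in> elts (terms \<Sigma> ?X)" and u: "u \<in> elts (terms \<Sigma> ?X)" and tu: "app e t = app e u" for t u
    proof -
      obtain Z where Z: "finite_in ?X Z" "t \<in> elts (terms \<Sigma> Z)" "u \<in> elts (terms \<Sigma> Z)"
        using finite_in_two_terms[OF t u x0] by blast
      obtain \<sigma> g \<rho> where *: "func \<sigma> (terms \<Sigma> ?X) (terms \<Sigma> omega)" "func \<rho> omega ?X"
        "\<forall>t\<in>elts (terms \<Sigma> ?X). app ?e0 (app \<sigma> t) = app g (app e t)"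
        "\<forall>t\<in>elts (terms \<Sigma> Z). app (evf omega A \<rho>) (app \<sigma> t) = app a t"
        using transfer[OF Z(1)] by blast
      have "eqn (app \<sigma> t) (app \<sigma> u) \<in> elts \<Gamma>"
        unfolding \<Gamma> sat_eqn is_identity_def using func_app[OF *(1)] t u tu *(3) by auto
      then have "sat_identity \<Sigma> A \<rho> (eqn (app \<sigma> t) (app \<sigma> u))" using A *(2) unfolding models_def by blast
      then show ?thesis using *(4) Z by (simp add: sat_eqn)
    qed
    have rel: "tmap (ar \<Sigma> r) a s \<in> elts (interp A r)"
      if r: "r \<in> elts (rels \<Sigma>)" and s: "func s (ar \<Sigma> r) (terms \<Sigma> ?X)"
        and es: "tmap (ar \<Sigma> r) e s \<in> elts (interp F r)" for r s
    proof -
      obtain Z where Z: "finite_in ?X Z" "func s (ar \<Sigma> r) (terms \<Sigma> Z)"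
        using finite_in_terms[OF s ar_rel[OF r] x0] by blast
      obtain \<sigma> g \<rho> where *: "func \<sigma> (terms \<Sigma> ?X) (terms \<Sigma> omega)" "is_hom \<Sigma> g F F0" "func \<rho> omega ?X"
        "\<forall>t\<in>elts (terms \<Sigma> ?X). app ?e0 (app \<sigma> t) = app g (app e t)"
        "\<forall>t\<in>elts (terms \<Sigma> Z). app (evf omega A \<rho>) (app \<sigma> t) = app a t"
        using transfer[OF Z(1)] by blast
      let ?s = "tmap (ar \<Sigma> r) \<sigma> s"
      have \<sigma>s: "func ?s (ar \<Sigma> r) (terms \<Sigma> omega)" by (rule func_tmap[OF *(1) s])
      have "tmap (ar \<Sigma> r) ?e0 ?s = tmap (ar \<Sigma> r) g (tmap (ar \<Sigma> r) e s)"
        by (rule lam_cong) (simp add: app_tmap[OF *(1) s] app_tmap[OF e s] *(4) func_app[OF s])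
      then have "tmap (ar \<Sigma> r) ?e0 ?s \<in> elts (interp F0 r)" using hom_rel[OF *(2) r es] by simp
      then have "relatom r ?s \<in> elts \<Gamma>"
        unfolding \<Gamma> sat_relatom is_identity_def elts_funs using r \<sigma>s by blast
      then have "sat_identity \<Sigma> A \<rho> (relatom r ?s)" using A *(3) unfolding models_def by blast
      moreover have "tmap (ar \<Sigma> r) (evf omega A \<rho>) ?s = tmap (ar \<Sigma> r) a s"
        by (rule lam_cong) (simp add: app_tmap[OF *(1) s] *(5) func_app[OF Z(2)])
      ultimately show ?thesis by (simp add: sat_relatom)
    qed
    \<comment> \<open>Every element of \<open>F\<close> is the value of a term, and by
      \<open>eq\<close> all terms with that value have the same value in \<open>A\<close>; the
      description thus replaces the choice of a term.\<close>
    let ?h = "\<lambda>y. THE z. \<exists>t\<in>elts (terms \<Sigma> ?X). app e t = y \<and> app a t = z"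
    have Th: "definable_term (\<lambda>e. ?h (e 0))"
      by (rule definable_term_the) (intro dfn definable_term_app[OF func_fun_on[OF e]] definable_term_app[OF func_fun_on[OF a]], use eq in metis)
    have h_val: "?h (app e t) = app a t" if "t \<in> elts (terms \<Sigma> ?X)" for t
      using that eq by (intro the_equality) blast+
    define h where "h = lam (univ F) ?h"
    have h_app: "app h (app e t) = app a t" if "t \<in> elts (terms \<Sigma> ?X)" for t
      using app_lam[OF Th, of "app e t" "univ F"] func_app[OF e that] h_val[OF that] by (simp add: h_def)
    have h: "func h (univ F) ?X"
      unfolding h_def
    proof (rule func_lam[OF Th])
      fix y assume "y \<in> elts (univ F)"
      then obtain t where t: "t \<in> elts (terms \<Sigma> ?X)" "y = app e t" unfolding F(3) e_def by blast
      show "?h y \<in> elts ?X" unfolding t(2) h_val[OF t(1)] by (rule func_app[OF a t(1)])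
    qed
    \<comment> \<open>Homomorphism conditions concern one finite tuple at a time, so its entries may
      be represented by terms through finite choice.\<close>
    have lift: "\<exists>s'. func s' n (terms \<Sigma> ?X) \<and> s = tmap n e s'"
      if n: "n \<in> elts omega" and s: "func s n (univ F)" for n s
    proof -
      have "\<exists>t\<in>elts (terms \<Sigma> ?X). app e t = app s k" if "k \<in> elts n" for k
        using func_app[OF s that] unfolding F(3) e_def by auto
      from lift_tuple[OF n e s this] show ?thesis by blast
    qed
    have ha: "tmap n h (tmap n e s) = tmap n a s" if "func s n (terms \<Sigma> ?X)" for n s
      by (rule lam_cong) (simp add: app_tmap[OF e that] h_app func_app[OF that])
    have "is_hom \<Sigma> h F A"
    proof (rule is_homI[OF h])
      fix f s assume f: "f \<in> elts (funcs \<Sigma>)" and s: "func s (ar \<Sigma> f) (univ F)"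
      obtain s' where s': "func s' (ar \<Sigma> f) (terms \<Sigma> ?X)" "s = tmap (ar \<Sigma> f) e s'"
        using lift[OF ar_func[OF f] s] by blast
      have "app (interp F f) s = app e (tapp f s')"
        unfolding s'(2) e_def by (rule evf_tapp[OF SF F(2) f s'(1), symmetric])
      then have "app h (app (interp F f) s) = app a (tapp f s')" using h_app[OF tapp_terms[OF f s'(1)]] by simp
      also have "\<dots> = app (interp A f) (tmap (ar \<Sigma> f) a s')"
        unfolding a_def by (rule evf_tapp[OF SA id f s'(1)])
      finally show "app h (app (interp F f) s) = app (interp A f) (tmap (ar \<Sigma> f) h s)"
        unfolding s'(2) ha[OF s'(1)] .
    next
      fix r s assume r: "r \<in> elts (rels \<Sigma>)" and s: "s \<in> elts (interp F r)"
      obtain s' where s': "func s' (ar \<Sigma> r) (terms \<Sigma> ?X)" "s = tmap (ar \<Sigma> r) e s'"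
        using lift[OF ar_rel[OF r] struct_rel[OF SF r s]] by blast
      then show "tmap (ar \<Sigma> r) h s \<in> elts (interp A r)" using rel[OF r s'(1)] s ha[OF s'(1)] by simp
    qed
    moreover have "\<exists>y\<in>elts (univ F). app h y = x" if x: "x \<in> elts ?X" for x
    proof
      show "app h (app e (tvar x)) = x"
        using h_app[OF tvar_terms[OF x]] evf_tvar[OF SA id x] id_app[OF x] by (simp add: a_def)
      show "app e (tvar x) \<in> elts (univ F)" by (rule func_app[OF e tvar_terms[OF x]])
    qed
    ultimately have "is_hom_image \<Sigma> A F" using SA SF unfolding is_hom_image_def by blast
    then show "A \<in> K" using F(1) closed(1) unfolding closed_hom_images_def by blast
  qed
  have "K = {A. is_struct \<Sigma> A \<and> (\<forall>p\<in>elts \<Gamma>. models \<Sigma> A p)}"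
    using sound complete K(2) by blast
  then show ?thesis unfolding is_variety_def using \<Gamma> by blast
qed

end

theorem theorem3p5:
  fixes \<Sigma> :: "'v::zf signature" and K :: "'v set"
  assumes "is_signature \<Sigma>"
    and "is_class K"
    and "\<And>A. A \<in> K \<Longrightarrow> is_struct \<Sigma> A"
  shows "is_variety \<Sigma> K \<longleftrightarrow>
           closed_hom_images \<Sigma> K \<and> closed_substructs \<Sigma> K \<and> closed_products \<Sigma> K"
proof -
  interpret signat \<Sigma> by standard (rule assms(1))
  show ?thesis using variety_closed closed_variety[OF assms(2,3)] by blast
qed

end
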